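(* Let $(3,b,c)$ be a triple of pairwise coprime positive integers such that none of the entries lies in the (additive) monoid generated by the other two. Then the Cox ring of $X(3,b,c)$ is as follows. After suitably reordering the triple $(3,b,c)$ as $(a',b',c')$, one has $2a'=nb'+mc'$ with positive integers $n,m$ such that $b'\ge 3m$ and $c'\ge 3n$, and, for $X=X(a',b',c')$, as a $\mathrm{Cl}(X)=\mathbb{Z}^2$-graded algebra, $$\mathcal{R}(X)=\mathbb{K}[x,y,z,s_1,\ldots,s_4,t]/(I_2:t^\infty),$$ $$Q=\begin{bmatrix} a' & b' & c' & 2a' & \tfrac{b'(c'+n)}{2} & \tfrac{c'(b'+m)}{2} & b'c' & 0\\ 0&0&0&-1&-1&-1&-2&1\end{bmatrix},$$ where the columns of $Q$ are the degrees of $x,y,z,s_1,\ldots,s_4,t$, whose Rees multiplicities are $0,0,0,1,1,1,2,-1$, respectively, and $I_2\subseteq\mathbb{K}[x,y,z,s_1,\ldots,s_4,t]$ is the ideal generated by $$x^2-y^nz^m-s_1t,\qquad xz^{\frac{b'-m}{2}}-y^{\frac{c'+n}{2}}-s_2t,\qquad xy^{\frac{c'-n}{2}}-z^{\frac{b'+m}{2}}-s_3t,$$ $$xy^{\frac{c'-3n}{2}}z^{\frac{b'-3m}{2}}s_1-y^{\frac{c'-n}{2}}s_2-z^{\frac{b'-m}{2}}s_3-s_4t,\qquad y^{\frac{c'-3n}{2}}z^{\frac{b'-3m}{2}}s_1^2-s_2s_3-xs_4,$$ $$y^{\frac{c'-n}{2}}s_1-z^ms_2-xs_3,\qquad z^{\frac{b'-m}{2}}s_1-xs_2-y^ns_3,$$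 $$s_3^2+y^{\frac{c'-3n}{2}}s_1s_2-z^ms_4,\qquad s_2^2+z^{\frac{b'-3m}{2}}s_1s_3-y^ns_4.$$
   Context: $\mathbb{K}$ is an algebraically closed field of characteristic zero. For pairwise coprime positive integers $a,b,c$, $\mathbb{P}(a,b,c)$ is the weighted projective plane over $\mathbb{K}$ with homogeneous coordinate ring $S=\mathbb{K}[x,y,z]$, $\mathbb{Z}$-graded by $\deg x=a$, $\deg y=b$, $\deg z=c$, and $X=X(a,b,c)$ is its blow-up at $[1,1,1]$. The divisor class group $\mathrm{Cl}(X)=\mathbb{Z}^2$ has basis the classes of $H$ (the pullback of a generator of $\mathrm{Cl}(\mathbb{P}(a,b,c))\cong\mathbb{Z}$ of degree one) and $E$ (the exceptional divisor); $(d,\mu)$ stands for $dH+\mu E$. The Cox ring is $\mathcal{R}(X)=\bigoplus_{D\in\mathrm{Cl}(X)}\Gamma(X,\mathcal{O}(D))$. Let $I\subseteq S$ be the weighted homogeneous ideal of the point $(1,1,1)$ (generated by all homogeneous polynomials of $S$ vanishing at $(1,1,1)$) and $J=\langle x,y,z\rangle$. The Cox ring of $X$ is identified with the saturated Rees algebra $\bigoplus_{(d,\mu)\in\mathbb{Z}^2}(I^{-\mu}:J^\infty)_d\,t^\mu$ (with $I^{k}=S$ for $k\le 0$), the $(d,\mu)$-component corresponding to $\mathcal{R}(X)_{dH+\mu E}$; $t$ is the canonical section of $E$. A homogeneous element has Rees multiplicity $\mu$ if its degree is $dH-\mu E$ for some $d$. $I_2:t^\infty$ denotes the saturation of $I_2$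 with respect to $t$. *)

theory Defs
  imports
    "HOL-Library.Poly_Mapping"
    "HOL-Library.Product_Plus"
    "HOL-Library.Multiset"
    "HOL-Algebra.Algebra"
    "HOL-Algebra.Algebraic_Closure_Type"
begin

section \<open>Polynomial rings and their ideals\<close>

text \<open>Polynomials over \<open>'k\<close> with variables the elements of \<open>'v\<close>: finitely supported maps from
  exponent vectors to coefficients, with the convolution product of \<open>Poly_Mapping\<close>.\<close>

type_synonym ('v, 'k) mpol = "('v \<Rightarrow>\<^sub>0 nat) \<Rightarrow>\<^sub>0 'k"

definition mvar :: "'v \<Rightarrow> ('v, 'k::comm_ring_1) mpol"
  where "mvar v = Poly_Mapping.single (Poly_Mapping.single v 1) 1"

definition mconst :: "'k::comm_ring_1 \<Rightarrow> ('v, 'k) mpol"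
  where "mconst c = Poly_Mapping.single 0 c"

definition mpol_eval :: "('v \<Rightarrow> 'k) \<Rightarrow> ('v, 'k::comm_ring_1) mpol \<Rightarrow> 'k"
  where "mpol_eval p f =
    (\<Sum>e\<in>Poly_Mapping.keys f. Poly_Mapping.lookup f e *
       (\<Prod>v\<in>Poly_Mapping.keys e. p v ^ Poly_Mapping.lookup e v))"

definition monomial_deg :: "('v \<Rightarrow> int) \<Rightarrow> ('v \<Rightarrow>\<^sub>0 nat) \<Rightarrow> int"
  where "monomial_deg w e = (\<Sum>v\<in>Poly_Mapping.keys e. int (Poly_Mapping.lookup e v) * w v)"

definition homogeneous_part :: "('v \<Rightarrow> int) \<Rightarrow> int \<Rightarrow> ('v, 'k::comm_ring_1) mpol set"
  where "homogeneous_part w d = {f. \<forall>e\<in>Poly_Mapping.keys f. monomial_deg w e = d}"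

abbreviation mpol_ring :: "('v, 'k::comm_ring_1) mpol ring"
  where "mpol_ring \<equiv> ring_of_type_algebra"

primrec ideal_power :: "('a, 'b) ring_scheme \<Rightarrow> 'a set \<Rightarrow> nat \<Rightarrow> 'a set"
  where
    "ideal_power R I 0 = carrier R"
  | "ideal_power R I (Suc k) = ideal_prod R I (ideal_power R I k)"

text \<open>\<open>I : J\<^sup>\<infinity>\<close>\<close>

definition ideal_saturation :: "('a, 'b) ring_scheme \<Rightarrow> 'a set \<Rightarrow> 'a set \<Rightarrow> 'a set"
  where "ideal_saturation R I J =
    {f \<in> carrier R. \<exists>N. \<forall>g\<in>ideal_power R J N. f \<otimes>\<^bsub>R\<^esub> g \<in> I}"


section \<open>The Cox ring of the blow-up of \<open>\<P>(a,b,c)\<close> at \<open>[1,1,1]\<close>\<close>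

datatype coord = Cx | Cy | Cz

fun coord_weight :: "nat \<Rightarrow> nat \<Rightarrow> nat \<Rightarrow> coord \<Rightarrow> int"
  where
    "coord_weight a b c Cx = int a"
  | "coord_weight a b c Cy = int b"
  | "coord_weight a b c Cz = int c"

definition point_ideal :: "nat \<Rightarrow> nat \<Rightarrow> nat \<Rightarrow> (coord, 'k::comm_ring_1) mpol set"
  where "point_ideal a b c = Idl\<^bsub>mpol_ring\<^esub>
    {f. (\<exists>d. f \<in> homogeneous_part (coord_weight a b c) d) \<and> mpol_eval (\<lambda>_. 1) f = 0}"

definition irrelevant_ideal :: "(coord, 'k::comm_ring_1) mpol set"
  where "irrelevant_ideal = Idl\<^bsub>mpol_ring\<^esub> {mvar Cx, mvar Cy, mvar Cz}"

text \<open>\<open>I\<^sup>k : J\<^sup>\<infinity>\<close>, where \<open>I\<^sup>k\<close> is the whole ring for \<open>k \<le> 0\<close> (as \<open>nat k = 0\<close> then).\<close>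

definition saturated_power ::
    "nat \<Rightarrow> nat \<Rightarrow> nat \<Rightarrow> int \<Rightarrow> (coord, 'k::comm_ring_1) mpol set"
  where "saturated_power a b c k =
    ideal_saturation mpol_ring (ideal_power mpol_ring (point_ideal a b c) (nat k)) irrelevant_ideal"

text \<open>Laurent polynomials in \<open>t\<close> over \<open>\<K>[x,y,z]\<close>; \<open>f t\<^sup>\<mu>\<close> is \<open>Poly_Mapping.single \<mu> f\<close>.\<close>

type_synonym 'k laurent_mpol = "int \<Rightarrow>\<^sub>0 (coord, 'k) mpol"

text \<open>The Cox ring is taken as the saturated Rees algebra, with \<open>(d, \<mu>)\<close> standing for the class
  \<open>d H + \<mu> E\<close>. The canonical section of \<open>E\<close> is \<open>Poly_Mapping.single 1 1\<close>, of degree \<open>(0, 1)\<close>.\<close>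

definition cox_component ::
    "nat \<Rightarrow> nat \<Rightarrow> nat \<Rightarrow> int \<times> int \<Rightarrow> 'k::comm_ring_1 laurent_mpol set"
  where "cox_component a b c D = Poly_Mapping.single (snd D) `
    (saturated_power a b c (- snd D) \<inter> homogeneous_part (coord_weight a b c) (fst D))"

definition cox_ring :: "nat \<Rightarrow> nat \<Rightarrow> nat \<Rightarrow> 'k::comm_ring_1 laurent_mpol ring"
  where "cox_ring a b c = ring_of_type_algebra
    \<lparr>carrier := {(\<Sum>D\<in>A. g D) | A g. finite A \<and> (\<forall>D\<in>A. g D \<in> cox_component a b c D)}\<rparr>"


section \<open>Generators and relations\<close>

datatype gen = Gx | Gy | Gz | Gs1 | Gs2 | Gs3 | Gs4 | Gt

fun gen_deg :: "nat \<Rightarrow> nat \<Rightarrow> nat \<Rightarrow> nat \<Rightarrow> nat \<Rightarrow> gen \<Rightarrow> int \<times> int"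
  where
    "gen_deg a b c n m Gx = (int a, 0)"
  | "gen_deg a b c n m Gy = (int b, 0)"
  | "gen_deg a b c n m Gz = (int c, 0)"
  | "gen_deg a b c n m Gs1 = (2 * int a, -1)"
  | "gen_deg a b c n m Gs2 = (int (b * (c + n) div 2), -1)"
  | "gen_deg a b c n m Gs3 = (int (c * (b + m) div 2), -1)"
  | "gen_deg a b c n m Gs4 = (int (b * c), -2)"
  | "gen_deg a b c n m Gt = (0, 1)"

definition bihomogeneous_part ::
    "('v \<Rightarrow> int \<times> int) \<Rightarrow> int \<times> int \<Rightarrow> ('v, 'k::comm_ring_1) mpol set"
  where "bihomogeneous_part Q D =
    homogeneous_part (fst \<circ> Q) (fst D) \<inter> homogeneous_part (snd \<circ> Q) (snd D)"

text \<open>The natural-number subtractions and divisions are exact for \<open>3 m \<le> b\<close>, \<open>3 n \<le> c\<close> with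
  \<open>b - m\<close> and \<open>c - n\<close> even, which is the only case of interest.\<close>

definition relations :: "nat \<Rightarrow> nat \<Rightarrow> nat \<Rightarrow> nat \<Rightarrow> (gen, 'k::comm_ring_1) mpol set"
  where "relations b c n m =
    (let x = mvar Gx; y = mvar Gy; z = mvar Gz;
         s1 = mvar Gs1; s2 = mvar Gs2; s3 = mvar Gs3; s4 = mvar Gs4; t = mvar Gt
     in {x ^ 2 - y ^ n * z ^ m - s1 * t,
         x * z ^ ((b - m) div 2) - y ^ ((c + n) div 2) - s2 * t,
         x * y ^ ((c - n) div 2) - z ^ ((b + m) div 2) - s3 * t,
         x * y ^ ((c - 3 * n) div 2) * z ^ ((b - 3 * m) div 2) * s1
           - y ^ ((c - n) div 2) * s2 - z ^ ((b - m) div 2) * s3 - s4 * t,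
         y ^ ((c - 3 * n) div 2) * z ^ ((b - 3 * m) div 2) * s1 ^ 2 - s2 * s3 - x * s4,
         y ^ ((c - n) div 2) * s1 - z ^ m * s2 - x * s3,
         z ^ ((b - m) div 2) * s1 - x * s2 - y ^ n * s3,
         s3 ^ 2 + y ^ ((c - 3 * n) div 2) * s1 * s2 - z ^ m * s4,
         s2 ^ 2 + z ^ ((b - 3 * m) div 2) * s1 * s3 - y ^ n * s4})"

definition relation_ideal :: "nat \<Rightarrow> nat \<Rightarrow> nat \<Rightarrow> nat \<Rightarrow> (gen, 'k::comm_ring_1) mpol set"
  where "relation_ideal b c n m = Idl\<^bsub>mpol_ring\<^esub> (relations b c n m)"

definition saturated_relation_ideal ::
    "nat \<Rightarrow> nat \<Rightarrow> nat \<Rightarrow> nat \<Rightarrow> (gen, 'k::comm_ring_1) mpol set"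
  where "saturated_relation_ideal b c n m =
    ideal_saturation mpol_ring (relation_ideal b c n m) (PIdl\<^bsub>mpol_ring\<^esub> (mvar Gt))"

end

theory Submission
  imports Defs
begin

text \<open>
  Write the reordered triple as \<open>(3n + q, 3, 3n + 2q)\<close> with \<open>m = 1\<close>. The kernel of the natural map from
  \<open>\<K>[x,y,z,s\<^sub>1,\<dots>,s\<^sub>4,t]\<close> to the Laurent polynomials in \<open>t\<close> is \<open>I\<^sub>2 : t\<^sup>\<infinity>\<close>, because the first four relations
  express \<open>s\<^sub>1,\<dots>,s\<^sub>4\<close> through \<open>x,y,z\<close> once \<open>t\<close> is inverted. The image lies in the saturated Rees algebra
  since \<open>x\<close>, \<open>z\<close> and \<open>y\<^sup>n\<close> multiply the polynomial of \<open>s\<^sub>4\<close> into \<open>I\<^sup>2\<close>.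

  For surjectivity, restrict to \<open>y = 1\<close> and to a generic line \<open>x = 1 + \<tau>\<alpha>\<close>, \<open>z = 1 + \<tau>\<gamma>\<close> through the point,
  with slope parameter \<open>v\<close>. A homogeneous element of \<open>I\<^sup>k : J\<^sup>\<infinity>\<close> restricts to a multiple of \<open>\<tau>\<^sup>k\<close>. By induction
  on \<open>k\<close> it suffices that an element of the image of Rees multiplicity \<open>k\<close> whose restriction vanishes to
  order more than \<open>k\<close> is divisible by \<open>t\<close> in the image. Modulo \<open>t\<close>, the image is spanned by the monomials
  \<open>y\<^sup>j s\<^sub>4\<^sup>l s\<^sub>1\<^sup>i \<beta>\<close> with \<open>\<beta> \<in> {1, s\<^sub>2, s\<^sub>3, x, x s\<^sub>2, x s\<^sub>3}\<close> and \<open>y\<^sup>j s\<^sub>4\<^sup>l z\<close>, whose leading coefficients along the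
  line are \<open>(1 - v + v\<^sup>2)\<^sup>l\<close> times \<open>1\<close>, \<open>v\<close> or \<open>1 - v\<close>. Comparing degrees modulo 3, in a fixed degree at most two
  monomials share the same \<open>l\<close>, and their factors are then linearly independent; hence so are all leading
  coefficients, by uniqueness of expansions in powers of \<open>1 - v + v\<^sup>2\<close>.
\<close>

section \<open>Homomorphisms out of polynomial rings\<close>

text \<open>Formulated on types rather than carriers, so that \<open>hom_simps\<close> can rewrite
  under all the substitutions below; carrier-based homomorphisms return only for the final
  quotient.\<close>

locale ring_homomorphism =
  fixes f :: "'a::comm_ring_1 \<Rightarrow> 'b::comm_ring_1"
  assumes hom_add: "f (x + y) = f x + f y"
    and hom_mult: "f (x * y) = f x * f y"
    and hom_one: "f 1 = 1"
begin

lemma hom_zero: "f 0 = 0"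
  using hom_add[of 0 0] by simp

lemma hom_uminus: "f (- x) = - f x"
  using hom_add[of x "- x"] by (simp add: hom_zero add_eq_0_iff)

lemma hom_diff: "f (x - y) = f x - f y"
  using hom_add[of x "- y"] by (simp add: hom_uminus)

lemma hom_power: "f (x ^ k) = f x ^ k"
  by (induction k) (simp_all add: hom_one hom_mult)

lemma hom_sum: "f (sum g A) = (\<Sum>i\<in>A. f (g i))"
  by (induction A rule: infinite_finite_induct) (simp_all add: hom_zero hom_add)

lemmas hom_simps = hom_add hom_mult hom_one hom_zero hom_uminus hom_diff hom_power

end

text \<open>An update at a key outside the support is the sum with a \<open>single\<close>, so
  additive statements need checking only on singles.\<close>

lemma poly_mapping_induct_add [case_names single add]:
  fixes p :: "'i \<Rightarrow>\<^sub>0 'b::comm_monoid_add"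
  assumes "\<And>i b. P (Poly_Mapping.single i b)"
    and "\<And>p q. P p \<Longrightarrow> P q \<Longrightarrow> P (p + q)"
  shows "P p"
proof (induction p rule: Poly_Mapping.update_induct)
  case const
  \<comment> \<open>The zero map is the single with coefficient 0 at an arbitrary index.\<close>
  then show ?case using assms(1)[of undefined 0] by simp
next
  case (update p i b)
  have "Poly_Mapping.update i b p = p + Poly_Mapping.single i b"
    using update(1)
    by (auto intro!: poly_mapping_eqI simp: lookup_update lookup_add lookup_single when_def in_keys_iff)
  then show ?case using assms update by metis
qed

text \<open>Used with two index sets: exponent vectors, which gives substitution into polynomials,
  and exponents of t, which gives \<open>lift_poly\<close>.\<close>

definition linear_extension :: "('i \<Rightarrow> 'b \<Rightarrow> 'r) \<Rightarrow> ('i \<Rightarrow>\<^sub>0 'b::comm_monoid_add) \<Rightarrow> 'r::comm_monoid_add"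
  where "linear_extension g p = (\<Sum>i\<in>Poly_Mapping.keys p. g i (Poly_Mapping.lookup p i))"

lemma linear_extension_superset:
  assumes "finite A" "Poly_Mapping.keys p \<subseteq> A" "\<And>i. g i 0 = 0"
  shows "linear_extension g p = (\<Sum>i\<in>A. g i (Poly_Mapping.lookup p i))"
  unfolding linear_extension_def
  by (rule sum.mono_neutral_left) (use assms in \<open>auto simp: in_keys_iff\<close>)

lemma linear_extension_single:
  assumes "\<And>i. g i 0 = 0"
  shows "linear_extension g (Poly_Mapping.single i b) = g i b"
  by (subst linear_extension_superset[of "{i}"]) (use assms in \<open>auto split: if_splits\<close>)

lemma linear_extension_add:
  assumes "\<And>i. g i 0 = 0" "\<And>i x y. g i (x + y) = g i x + g i y"
  shows "linear_extension g (p + q) = linear_extension g p + linear_extension g q"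
proof -
  let ?A = "Poly_Mapping.keys p \<union> Poly_Mapping.keys q"
  have "finite ?A" "Poly_Mapping.keys (p + q) \<subseteq> ?A"
    using keys_add[of p q] by auto
  then show ?thesis
    using assms by (simp add: linear_extension_superset[of ?A] lookup_add sum.distrib)
qed

text \<open>Both sides are additive in p and in q, which reduces the claim to two singles.\<close>

lemma linear_extension_mult:
  fixes g :: "'i::monoid_add \<Rightarrow> 'b::semiring_0 \<Rightarrow> 'r::semiring_0"
  assumes zero: "\<And>i. g i 0 = 0" and add: "\<And>i x y. g i (x + y) = g i x + g i y"
    and mult: "\<And>i j x y. g (i + j) (x * y) = g i x * g j y"
  shows "linear_extension g (p * q) = linear_extension g p * linear_extension g q"
proof (induction p rule: poly_mapping_induct_add)
  case (single i b)
  show ?case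
  proof (induction q rule: poly_mapping_induct_add)
    case (single j c)
    then show ?case by (simp add: mult_single linear_extension_single zero mult)
  next
    case (add p q)
    then show ?case by (simp add: distrib_left linear_extension_add zero assms(2))
  qed
next
  case (add p q)
  then show ?case by (simp add: distrib_right linear_extension_add zero assms(2))
qed

section \<open>Substitution into polynomials\<close>

definition eval_monomial :: "('v \<Rightarrow> 'r::comm_ring_1) \<Rightarrow> ('v \<Rightarrow>\<^sub>0 nat) \<Rightarrow> 'r"
  where "eval_monomial h e = (\<Prod>v\<in>Poly_Mapping.keys e. h v ^ Poly_Mapping.lookup e v)"

lemma eval_monomial_superset:
  assumes "finite A" "Poly_Mapping.keys e \<subseteq> A"
  shows "eval_monomial h e = (\<Prod>v\<in>A. h v ^ Poly_Mapping.lookup e v)"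
  unfolding eval_monomial_def
  by (rule prod.mono_neutral_left) (use assms in \<open>auto simp: in_keys_iff\<close>)

lemma eval_monomial_zero: "eval_monomial h 0 = 1"
  by (simp add: eval_monomial_def)

lemma eval_monomial_single: "eval_monomial h (Poly_Mapping.single v k) = h v ^ k"
  by (subst eval_monomial_superset[of "{v}"]) (auto split: if_splits)

lemma eval_monomial_add: "eval_monomial h (e + e') = eval_monomial h e * eval_monomial h e'"
proof -
  let ?A = "Poly_Mapping.keys e \<union> Poly_Mapping.keys e'"
  have "finite ?A" "Poly_Mapping.keys (e + e') \<subseteq> ?A"
    using keys_add[of e e'] by auto
  then show ?thesis
    by (simp add: eval_monomial_superset[of ?A] lookup_add power_add prod.distrib)
qed

definition mpol_subst :: "('k \<Rightarrow> 'r) \<Rightarrow> ('v \<Rightarrow> 'r::comm_ring_1) \<Rightarrow> ('v, 'k::comm_ring_1) mpol \<Rightarrow> 'r"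
  where "mpol_subst \<kappa> h = linear_extension (\<lambda>e c. \<kappa> c * eval_monomial h e)"

context ring_homomorphism
begin

lemma mpol_subst_single: "mpol_subst f h (Poly_Mapping.single e c) = f c * eval_monomial h e"
  by (simp add: mpol_subst_def linear_extension_single hom_zero)

lemma mpol_subst_mvar: "mpol_subst f h (mvar v) = h v"
  by (simp add: mvar_def mpol_subst_single hom_one eval_monomial_single)

lemma mpol_subst_mconst: "mpol_subst f h (mconst c) = f c"
  by (simp add: mconst_def mpol_subst_single eval_monomial_zero)

lemma mpol_subst_homomorphism: "ring_homomorphism (mpol_subst f h)"
proof
  fix p q
  show "mpol_subst f h (p + q) = mpol_subst f h p + mpol_subst f h q"
    unfolding mpol_subst_def by (rule linear_extension_add) (auto simp: hom_simps algebra_simps)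
  show "mpol_subst f h (p * q) = mpol_subst f h p * mpol_subst f h q"
    unfolding mpol_subst_def
    by (rule linear_extension_mult) (auto simp: hom_simps algebra_simps eval_monomial_add)
  show "mpol_subst f h 1 = 1"
    unfolding single_one[symmetric] by (subst mpol_subst_single) (simp add: hom_one eval_monomial_zero)
qed

end

text \<open>Constants and variables generate the polynomial ring. An exponent vector is itself a
  finitely supported map, so the additive induction applies to it as well and builds a monomial
  factor by factor.\<close>

lemma mpol_induct [case_names const var add mult]:
  fixes p :: "('v, 'k::comm_ring_1) mpol"
  assumes const: "\<And>c. P (mconst c)" and var: "\<And>v. P (mvar v)"
    and add: "\<And>p q. P p \<Longrightarrow> P q \<Longrightarrow> P (p + q)" and mult: "\<And>p q. P p \<Longrightarrow> P q \<Longrightarrow> P (p * q)"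
  shows "P p"
proof (induction p rule: poly_mapping_induct_add)
  case (single e c)
  have *: "P (Poly_Mapping.single e 1)"
  proof (induction e rule: poly_mapping_induct_add)
    case (single v k)
    show ?case
    proof (induction k)
      case 0
      then show ?case using const[of 1] by (simp add: mconst_def)
    next
      case (Suc k)
      have "Poly_Mapping.single (Poly_Mapping.single v (Suc k)) (1::'k)
          = mvar v * Poly_Mapping.single (Poly_Mapping.single v k) 1"
        by (simp add: mvar_def mult_single single_add[symmetric])
      then show ?case using Suc var mult by simp
    qed
  next
    case (add e e')
    then show ?case using mult[OF add] by (simp add: mult_single)
  qed
  have "Poly_Mapping.single e c = mconst c * Poly_Mapping.single e 1"
    by (simp add: mconst_def mult_single)
  then show ?case using mult[OF const *] by simp
qed (rule add)

lemma ring_homomorphism_eqI: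
  fixes f g :: "('v, 'k::comm_ring_1) mpol \<Rightarrow> 'r::comm_ring_1"
  assumes "ring_homomorphism f" "ring_homomorphism g"
    and "\<And>c. f (mconst c) = g (mconst c)" "\<And>v. f (mvar v) = g (mvar v)"
  shows "f p = g p"
proof -
  interpret f: ring_homomorphism f by fact
  interpret g: ring_homomorphism g by fact
  show ?thesis
    by (induction p rule: mpol_induct) (simp_all add: assms f.hom_simps g.hom_simps)
qed

lemma mconst_homomorphism: "ring_homomorphism (mconst :: 'k \<Rightarrow> ('v, 'k::comm_ring_1) mpol)"
  by unfold_locales (simp_all add: mconst_def single_add mult_single)

lemma single_homomorphism:
  "ring_homomorphism (Poly_Mapping.single 0 :: 'b \<Rightarrow> ('i::comm_monoid_add \<Rightarrow>\<^sub>0 'b::comm_ring_1))"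
  by unfold_locales (simp_all add: single_add mult_single)

lemma ring_homomorphism_comp:
  "ring_homomorphism f \<Longrightarrow> ring_homomorphism g \<Longrightarrow> ring_homomorphism (\<lambda>x. f (g x))"
  unfolding ring_homomorphism_def by simp

lemma
  fixes p :: "'v \<Rightarrow> 'a::comm_ring_1"
  shows mpol_eval_homomorphism: "ring_homomorphism (mpol_eval p)"
  and mpol_eval_mvar: "mpol_eval p (mvar v) = p v"
  and mpol_eval_mconst: "mpol_eval p (mconst c) = c"
proof -
  interpret ring_homomorphism "\<lambda>x::'a. x" by unfold_locales simp_all
  have *: "mpol_eval p = mpol_subst (\<lambda>x. x) p" for p :: "'v \<Rightarrow> 'a"
    by (rule ext) (simp add: mpol_eval_def mpol_subst_def linear_extension_def eval_monomial_def)
  show "ring_homomorphism (mpol_eval p)" "mpol_eval p (mvar v) = p v" "mpol_eval p (mconst c) = c"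
    by (simp_all add: * mpol_subst_homomorphism mpol_subst_mvar mpol_subst_mconst)
qed

section \<open>Weighted degrees and homogeneous parts\<close>

lemma monomial_deg_superset:
  assumes "finite A" "Poly_Mapping.keys e \<subseteq> A"
  shows "monomial_deg w e = (\<Sum>v\<in>A. int (Poly_Mapping.lookup e v) * w v)"
  unfolding monomial_deg_def
  by (rule sum.mono_neutral_left) (use assms in \<open>auto simp: in_keys_iff\<close>)

lemma monomial_deg_zero [simp]: "monomial_deg w 0 = 0"
  by (simp add: monomial_deg_def)

lemma monomial_deg_single [simp]: "monomial_deg w (Poly_Mapping.single v k) = int k * w v"
  by (subst monomial_deg_superset[of "{v}"]) (auto split: if_splits)

lemma monomial_deg_add: "monomial_deg w (e + e') = monomial_deg w e + monomial_deg w e'"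
proof -
  let ?A = "Poly_Mapping.keys e \<union> Poly_Mapping.keys e'"
  have "finite ?A" "Poly_Mapping.keys (e + e') \<subseteq> ?A"
    using keys_add[of e e'] by auto
  then show ?thesis
    by (simp add: monomial_deg_superset[of ?A] lookup_add sum.distrib algebra_simps)
qed

lemma homogeneous_part_add:
  "f \<in> homogeneous_part w d \<Longrightarrow> g \<in> homogeneous_part w d \<Longrightarrow> f + g \<in> homogeneous_part w d"
  using keys_add[of f g] by (auto simp: homogeneous_part_def)

lemma homogeneous_part_uminus: "f \<in> homogeneous_part w d \<Longrightarrow> - f \<in> homogeneous_part w d"
  by (simp add: homogeneous_part_def in_keys_iff)

lemma homogeneous_part_diff:
  "f \<in> homogeneous_part w d \<Longrightarrow> g \<in> homogeneous_part w d \<Longrightarrow> f - g \<in> homogeneous_part w d"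
  using homogeneous_part_add[OF _ homogeneous_part_uminus] by fastforce

lemma homogeneous_part_zero: "0 \<in> homogeneous_part w d"
  by (simp add: homogeneous_part_def)

lemma homogeneous_part_mult:
  "f \<in> homogeneous_part w d \<Longrightarrow> g \<in> homogeneous_part w d' \<Longrightarrow> f * g \<in> homogeneous_part w (d + d')"
  using keys_mult[of f g] by (fastforce simp: homogeneous_part_def monomial_deg_add)

lemma homogeneous_part_mconst: "mconst c \<in> homogeneous_part w 0"
  by (simp add: homogeneous_part_def mconst_def)

lemma homogeneous_part_mvar: "mvar v \<in> homogeneous_part w (w v)"
  by (simp add: homogeneous_part_def mvar_def)

lemma homogeneous_part_one: "1 \<in> homogeneous_part w 0"
  by (simp add: homogeneous_part_def)

lemma homogeneous_part_power:
  "f \<in> homogeneous_part w d \<Longrightarrow> f ^ k \<in> homogeneous_part w (int k * d)"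
proof (induction k)
  case (Suc k)
  then show ?case using homogeneous_part_mult[OF Suc(2) Suc.IH] by (simp add: algebra_simps)
qed (simp add: homogeneous_part_one)

section \<open>Ideal powers and saturation\<close>

text \<open>The same object as \<open>mpol_ring\<close>, for an arbitrary commutative ring type
  instead of polynomials.\<close>

abbreviation (input) type_ring :: "'a::comm_ring_1 ring"
  where "type_ring \<equiv> ring_of_type_algebra"

lemma type_ring_simps [simp]:
  "carrier (type_ring :: 'a::comm_ring_1 ring) = UNIV"
  "x \<oplus>\<^bsub>type_ring\<^esub> y = x + y" "x \<otimes>\<^bsub>type_ring\<^esub> y = x * y"
  "\<one>\<^bsub>type_ring\<^esub> = (1 :: 'a)" "\<zero>\<^bsub>type_ring\<^esub> = (0 :: 'a)"
  by (simp_all add: ring_of_type_algebra_def)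

text \<open>The rewrites turn facts about rings with a carrier into facts about the operations of
  the type class.\<close>

interpretation type_ring: cring "type_ring :: 'a::comm_ring_1 ring"
  rewrites "carrier (type_ring :: 'a ring) = UNIV"
    and "\<And>x y. x \<oplus>\<^bsub>type_ring\<^esub> y = (x :: 'a) + y" and "\<And>x y. x \<otimes>\<^bsub>type_ring\<^esub> y = (x :: 'a) * y"
    and "\<one>\<^bsub>type_ring\<^esub> = (1 :: 'a)" and "\<zero>\<^bsub>type_ring\<^esub> = (0 :: 'a)"
  by (rule cring_from_type_algebra) simp_all

text \<open>Closure under negatives comes from multiplication by -1, so the three clauses make up
  the whole ideal criterion.\<close>

lemma ideal_type_ring_iff:
  "ideal I (type_ring :: 'a::comm_ring_1 ring) \<longleftrightarrow>
     0 \<in> I \<and> (\<forall>x\<in>I. \<forall>y\<in>I. x + y \<in> I) \<and> (\<forall>x\<in>I. \<forall>r. r * x \<in> I)"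
proof
  assume "ideal I (type_ring :: 'a ring)"
  then interpret ideal I "type_ring :: 'a ring" .
  show "0 \<in> I \<and> (\<forall>x\<in>I. \<forall>y\<in>I. x + y \<in> I) \<and> (\<forall>x\<in>I. \<forall>r. r * x \<in> I)"
    using zero_closed a_closed I_l_closed by simp
next
  assume I: "0 \<in> I \<and> (\<forall>x\<in>I. \<forall>y\<in>I. x + y \<in> I) \<and> (\<forall>x\<in>I. \<forall>r. r * x \<in> I)"
  show "ideal I (type_ring :: 'a ring)"
  proof (rule idealI)
    show "subgroup I (add_monoid (type_ring :: 'a ring))"
    proof (rule group.subgroupI)
      show "Group.group (add_monoid (type_ring :: 'a ring))"
        by (rule abelian_group.a_group[OF ring.is_abelian_group[OF ring_from_type_algebra]])
      fix x assume x: "x \<in> I"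
      have "inv\<^bsub>add_monoid type_ring\<^esub> x = \<ominus>\<^bsub>type_ring\<^esub> x"
        by (simp add: a_inv_def)
      also have "\<dots> = - x"
        using type_ring.minus_equality[of "- x" x] by simp
      finally show "inv\<^bsub>add_monoid type_ring\<^esub> x \<in> I"
        using I x by (metis mult_minus1)
    qed (use I in auto)
  qed (use I type_ring.ring_axioms in \<open>auto simp: mult.commute\<close>)
qed

lemma genideal_subset_idealI:
  assumes "ideal I (type_ring :: 'a::comm_ring_1 ring)" "S \<subseteq> I"
  shows "Idl\<^bsub>type_ring\<^esub> S \<subseteq> I"
  using type_ring.genideal_minimal assms by blast

lemma genideal_supset: "S \<subseteq> Idl\<^bsub>type_ring :: 'a::comm_ring_1 ring\<^esub> S"
  by (rule type_ring.genideal_self) simp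

lemma genideal_ideal: "ideal (Idl\<^bsub>type_ring :: 'a::comm_ring_1 ring\<^esub> S) type_ring"
  by (rule type_ring.genideal_ideal) simp

text \<open>The preimage of a principal ideal. For d = 0 it is the kernel; for d = \<tau> it
  consists of the elements whose restriction to the line vanishes at \<tau> = 0.\<close>

lemma ideal_dvd_hom:
  fixes f :: "'a::comm_ring_1 \<Rightarrow> 'b::comm_ring_1"
  assumes "ring_homomorphism f"
  shows "ideal {x. d dvd f x} type_ring"
proof -
  interpret ring_homomorphism f by fact
  show ?thesis by (auto simp: ideal_type_ring_iff hom_simps)
qed

section \<open>Powers of an ideal\<close>

lemma ideal_power_ideal:
  "ideal I (type_ring :: 'a::comm_ring_1 ring) \<Longrightarrow> ideal (ideal_power type_ring I k) type_ring"
  by (induction k) (auto simp: ideal_type_ring_iff[of UNIV] intro: type_ring.ideal_prod_is_ideal)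

lemma ideal_power_add:
  assumes "ideal I (type_ring :: 'a::comm_ring_1 ring)"
  shows "ideal_power type_ring I (k + l) =
    ideal_prod type_ring (ideal_power type_ring I k) (ideal_power type_ring I l)"
proof (induction k)
  case 0
  show ?case
    using type_ring.ideal_prod_one[OF ideal_power_ideal[OF assms, of l]]
      type_ring.ideal_prod_commute[OF ideal_power_ideal[OF assms, of l] type_ring.oneideal] by simp
next
  case (Suc k)
  then show ?case
    using type_ring.ideal_prod_assoc[OF assms ideal_power_ideal[OF assms, of k]
        ideal_power_ideal[OF assms, of l]] by simp
qed

lemma ideal_power_mult_mem:
  assumes "ideal I (type_ring :: 'a::comm_ring_1 ring)"
    and "x \<in> ideal_power type_ring I k" "y \<in> ideal_power type_ring I l"
  shows "x * y \<in> ideal_power type_ring I (k + l)"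
  using ideal_prod.prod[OF assms(2,3), of type_ring] ideal_power_add[OF assms(1)] by simp

lemma ideal_power_antimono:
  assumes "ideal I (type_ring :: 'a::comm_ring_1 ring)" "k \<le> l"
  shows "ideal_power type_ring I l \<subseteq> ideal_power type_ring I k"
proof -
  obtain j where "l = k + j" using assms(2) le_Suc_ex by blast
  then show ?thesis
    using ideal_power_add[OF assms(1)]
      type_ring.ideal_prod_inter[OF ideal_power_ideal[OF assms(1), of k] ideal_power_ideal[OF assms(1), of j]]
    by auto
qed

lemma power_mem_ideal_power:
  assumes "x \<in> I" shows "x ^ k \<in> ideal_power (type_ring :: 'a::comm_ring_1 ring) I k"
proof (induction k)
  case (Suc k)
  then show ?case using ideal_prod.prod[OF assms Suc, of type_ring] by simp
qed simp

lemma mem_ideal_power_one: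
  assumes "x \<in> I" shows "x \<in> ideal_power (type_ring :: 'a::comm_ring_1 ring) I 1"
  using power_mem_ideal_power[OF assms, of 1] by simp

text \<open>The elements g with f g in I are closed under sums, so it suffices to test the products
  that generate J K.\<close>

lemma ideal_power_subset_colon:
  assumes "ideal I (type_ring :: 'a::comm_ring_1 ring)"
    and "\<And>x y. x \<in> J \<Longrightarrow> y \<in> K \<Longrightarrow> f * (x * y) \<in> I"
    and "g \<in> ideal_prod type_ring J K"
  shows "f * g \<in> I"
  using assms(3)
proof (induction rule: ideal_prod.induct)
  case (prod i j)
  then show ?case using assms(2) by simp
next
  case (sum s1 s2)
  then show ?case using assms(1) by (simp add: distrib_left ideal_type_ring_iff)
qed

text \<open>If J^M carries f into I^k and J^N carries g into I^l, then J^(M+N) carries f g into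
  I^(k+l).\<close>

lemma ideal_saturation_mult:
  assumes "ideal I (type_ring :: 'a::comm_ring_1 ring)" "ideal J type_ring"
    and f: "f \<in> ideal_saturation type_ring (ideal_power type_ring I k) J"
    and g: "g \<in> ideal_saturation type_ring (ideal_power type_ring I l) J"
  shows "f * g \<in> ideal_saturation type_ring (ideal_power type_ring I (k + l)) J"
proof -
  obtain M where M: "f * x \<in> ideal_power type_ring I k" if "x \<in> ideal_power type_ring J M" for x
    using f by (auto simp: ideal_saturation_def)
  obtain N where N: "g * x \<in> ideal_power type_ring I l" if "x \<in> ideal_power type_ring J N" for x
    using g by (auto simp: ideal_saturation_def)
  have "f * g * w \<in> ideal_power type_ring I (k + l)" if w: "w \<in> ideal_power type_ring J (M + N)" for w
  proof (rule ideal_power_subset_colon)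
    show "ideal (ideal_power type_ring I (k + l)) (type_ring :: 'a ring)"
      by (rule ideal_power_ideal) fact
    show "w \<in> ideal_prod type_ring (ideal_power type_ring J M) (ideal_power type_ring J N)"
      using w ideal_power_add[OF assms(2)] by simp
    fix x y assume "x \<in> ideal_power type_ring J M" "y \<in> ideal_power type_ring J N"
    from ideal_power_mult_mem[OF assms(1) M[OF this(1)] N[OF this(2)]]
    show "f * g * (x * y) \<in> ideal_power type_ring I (k + l)"
      by (simp add: ac_simps)
  qed
  then show ?thesis by (auto simp: ideal_saturation_def)
qed

lemma ideal_saturation_ideal:
  assumes I: "ideal I (type_ring :: 'a::comm_ring_1 ring)" and J: "ideal J type_ring"
  shows "ideal (ideal_saturation type_ring I J) type_ring"
  unfolding ideal_type_ring_iff
proof (intro conjI ballI allI)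
  show "0 \<in> ideal_saturation type_ring I J"
    using I by (auto simp: ideal_saturation_def ideal_type_ring_iff)
next
  fix x y assume "x \<in> ideal_saturation type_ring I J" "y \<in> ideal_saturation type_ring I J"
  then obtain M N where MN: "\<forall>g\<in>ideal_power type_ring J M. x * g \<in> I"
      "\<forall>g\<in>ideal_power type_ring J N. y * g \<in> I"
    by (auto simp: ideal_saturation_def)
  have "(x + y) * g \<in> I" if "g \<in> ideal_power type_ring J (max M N)" for g
  proof -
    have "x * g \<in> I" "y * g \<in> I"
      using that MN ideal_power_antimono[OF J, of M "max M N"]
        ideal_power_antimono[OF J, of N "max M N"] by auto
    then show ?thesis using I by (simp add: distrib_right ideal_type_ring_iff)
  qed
  then show "x + y \<in> ideal_saturation type_ring I J"
    by (auto simp: ideal_saturation_def)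
next
  fix x r assume "x \<in> ideal_saturation type_ring I J"
  then obtain N where "\<forall>g\<in>ideal_power type_ring J N. x * g \<in> I"
    by (auto simp: ideal_saturation_def)
  then have "\<forall>g\<in>ideal_power type_ring J N. r * x * g \<in> I"
    using I by (auto simp: ideal_type_ring_iff mult.assoc)
  then show "r * x \<in> ideal_saturation type_ring I J"
    by (auto simp: ideal_saturation_def)
qed

lemma ideal_saturation_mono: "I \<subseteq> I' \<Longrightarrow> ideal_saturation R I J \<subseteq> ideal_saturation R I' J"
  by (auto simp: ideal_saturation_def)

text \<open>The N-th power of (t) contains t^N and consists of multiples of it, so only the powers
  of t have to be tested.\<close>

lemma ideal_saturation_principal:
  fixes t :: "'a::comm_ring_1"
  assumes I: "ideal I type_ring"
  shows "ideal_saturation type_ring I (PIdl\<^bsub>type_ring\<^esub> t) = {f. \<exists>N. f * t ^ N \<in> I}"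
proof -
  have dvd: "ideal_power type_ring (PIdl\<^bsub>type_ring\<^esub> t) N \<subseteq> {x. t ^ N dvd x}" for N
  proof (induction N)
    case (Suc N)
    have "x \<in> {x. t ^ Suc N dvd x}"
      if "x \<in> ideal_prod type_ring (PIdl\<^bsub>type_ring\<^esub> t) (ideal_power type_ring (PIdl\<^bsub>type_ring\<^esub> t) N)" for x
      using that
    proof (induction rule: ideal_prod.induct)
      case (prod i j)
      then show ?case using Suc by (auto simp: cgenideal_def intro!: mult_dvd_mono)
    qed (auto simp: dvd_add)
    then show ?case by auto
  qed simp
  have "t \<in> PIdl\<^bsub>type_ring\<^esub> t"
    by (auto simp: cgenideal_def intro!: exI[of _ 1])
  then have t: "t ^ N \<in> ideal_power type_ring (PIdl\<^bsub>type_ring\<^esub> t) N" for N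
    by (rule power_mem_ideal_power)
  show ?thesis
  proof (intro equalityI subsetI)
    fix f assume "f \<in> ideal_saturation type_ring I (PIdl\<^bsub>type_ring\<^esub> t)"
    then show "f \<in> {f. \<exists>N. f * t ^ N \<in> I}"
      using t by (auto simp: ideal_saturation_def)
  next
    fix f assume "f \<in> {f. \<exists>N. f * t ^ N \<in> I}"
    then obtain N where N: "f * t ^ N \<in> I" by blast
    have "f * g \<in> I" if g: "g \<in> ideal_power type_ring (PIdl\<^bsub>type_ring\<^esub> t) N" for g
    proof -
      obtain r where "g = t ^ N * r"
        using dvd[of N] g by (auto simp: dvd_def)
      then have "f * g = r * (f * t ^ N)" by (simp add: ac_simps)
      then show ?thesis using I N by (simp add: ideal_type_ring_iff)
    qed
    then show "f \<in> ideal_saturation type_ring I (PIdl\<^bsub>type_ring\<^esub> t)"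
      by (auto simp: ideal_saturation_def)
  qed
qed

text \<open>Multiplying f by a power of y brings it into I^k without changing its image, because y
  goes to 1. It serves to bound from below the order of vanishing along the line of elements of a
  saturated power.\<close>

lemma power_dvd_hom_ideal_saturation:
  fixes \<Psi> :: "'a::comm_ring_1 \<Rightarrow> 'b::comm_ring_1"
  assumes "ring_homomorphism \<Psi>" "\<And>x. x \<in> I \<Longrightarrow> \<tau> dvd \<Psi> x" "y \<in> J" "\<Psi> y = 1"
    and f: "f \<in> ideal_saturation type_ring (ideal_power type_ring I k) J"
  shows "\<tau> ^ k dvd \<Psi> f"
proof -
  interpret ring_homomorphism \<Psi> by fact
  have *: "\<tau> ^ k dvd \<Psi> x" if "x \<in> ideal_power type_ring I k" for x k
    using that
  proof (induction k arbitrary: x)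
    case (Suc k)
    from Suc(2) have "x \<in> ideal_prod type_ring I (ideal_power type_ring I k)" by simp
    then show ?case
    proof (induction rule: ideal_prod.induct)
      case (prod i j)
      then show ?case using Suc assms(2) by (simp add: hom_mult mult_dvd_mono)
    qed (auto simp: hom_add)
  qed simp
  obtain N where "f * y ^ N \<in> ideal_power type_ring I k"
    using f power_mem_ideal_power[OF assms(3)] by (auto simp: ideal_saturation_def)
  from *[OF this] show ?thesis by (simp add: hom_simps assms(4))
qed

lemma irrelevant_ideal_ideal: "ideal (irrelevant_ideal :: (coord, 'k::comm_ring_1) mpol set) type_ring"
  unfolding irrelevant_ideal_def by (rule genideal_ideal)

lemma mvar_mem_irrelevant_ideal: "mvar v \<in> (irrelevant_ideal :: (coord, 'k::comm_ring_1) mpol set)"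
  using genideal_supset[of "{mvar Cx, mvar Cy, mvar Cz :: (coord, 'k) mpol}"]
  by (cases v) (auto simp: irrelevant_ideal_def)

text \<open>The N-th power of (x, y, z) is contained in (x, y^N, z), so the three memberships
  suffice.\<close>

lemma mem_irrelevant_saturationI:
  fixes f :: "(coord, 'k::comm_ring_1) mpol"
  assumes I: "ideal I type_ring"
    and f: "f * mvar Cx \<in> I" "f * mvar Cy ^ N \<in> I" "f * mvar Cz \<in> I"
  shows "f \<in> ideal_saturation type_ring I irrelevant_ideal"
proof -
  let ?x = "mvar Cx :: (coord, 'k) mpol" and ?y = "mvar Cy :: (coord, 'k) mpol"
    and ?z = "mvar Cz :: (coord, 'k) mpol"
  \<comment> \<open>The ideal generated by x, y^k and z, with explicit coefficients.\<close>
  let ?C = "\<lambda>k. {g. \<exists>u v w. g = u * ?x + v * ?y ^ k + w * ?z}"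
  have C: "ideal (?C k) type_ring" for k
    unfolding ideal_type_ring_iff
  proof (intro conjI ballI allI)
    show "0 \<in> ?C k"
      by (simp, intro exI[of _ 0], simp)
  next
    fix g g' assume "g \<in> ?C k" "g' \<in> ?C k"
    then obtain u v w u' v' w' where
      "g = u * ?x + v * ?y ^ k + w * ?z" "g' = u' * ?x + v' * ?y ^ k + w' * ?z" by blast
    then have "g + g' = (u + u') * ?x + (v + v') * ?y ^ k + (w + w') * ?z" by (simp add: algebra_simps)
    then show "g + g' \<in> ?C k" by blast
  next
    fix g r assume "g \<in> ?C k"
    then obtain u v w where "g = u * ?x + v * ?y ^ k + w * ?z" by blast
    then have "r * g = (r * u) * ?x + (r * v) * ?y ^ k + (r * w) * ?z" by (simp add: algebra_simps)
    then show "r * g \<in> ?C k" by blast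
  qed
  have J1: "(irrelevant_ideal :: (coord, 'k) mpol set) \<subseteq> ?C 1"
    unfolding irrelevant_ideal_def
  proof (rule genideal_subset_idealI[OF C])
    have "?x = 1 * ?x + 0 * ?y ^ 1 + 0 * ?z" "?y = 0 * ?x + 1 * ?y ^ 1 + 0 * ?z"
         "?z = 0 * ?x + 0 * ?y ^ 1 + 1 * ?z" by simp_all
    then show "{?x, ?y, ?z} \<subseteq> ?C 1" by blast
  qed
  have "ideal_power type_ring irrelevant_ideal k \<subseteq> ?C k" for k
  proof (induction k)
    case 0
    have "g = 0 * ?x + g * ?y ^ 0 + 0 * ?z" for g by simp
    then show ?case by blast
  next
    case (Suc k)
    have "g \<in> ?C (Suc k)" if "g \<in> ideal_prod type_ring irrelevant_ideal (ideal_power type_ring irrelevant_ideal k)" for g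
      using that
    proof (induction rule: ideal_prod.induct)
      case (prod i j)
      obtain u v w u' v' w' where
        "i = u * ?x + v * ?y + w * ?z" "j = u' * ?x + v' * ?y ^ k + w' * ?z"
        using prod J1 Suc by fastforce
      \<comment> \<open>Only v v' y^(k+1) is left once every term divisible by x or z is split
        off.\<close>
      then have "i * j = (u * j + v * u' * ?y) * ?x + (v * v') * ?y ^ Suc k + (w * j + v * w' * ?y) * ?z"
        by (simp add: algebra_simps)
      then show ?case by auto
    next
      case (sum g g')
      then show ?case using C[of "Suc k"] by (simp only: ideal_type_ring_iff type_ring_simps)
    qed
    then show ?case by (simp only: ideal_power.simps) blast
  qed
  then have "f * g \<in> I" if g: "g \<in> ideal_power type_ring irrelevant_ideal N" for g
  proof -
    obtain u v w where "g = u * ?x + v * ?y ^ N + w * ?z"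
      using g \<open>\<And>k. ideal_power type_ring irrelevant_ideal k \<subseteq> ?C k\<close>[of N] by blast
    then have "f * g = u * (f * ?x) + v * (f * ?y ^ N) + w * (f * ?z)"
      by (simp add: algebra_simps)
    then show ?thesis using I f by (simp add: ideal_type_ring_iff)
  qed
  then show ?thesis by (auto simp: ideal_saturation_def)
qed

section \<open>The map to the Rees algebra and its kernel\<close>

lemma single_power:
  "Poly_Mapping.single (i::int) (a::'b::comm_ring_1) ^ k = Poly_Mapping.single (int k * i) (a ^ k)"
  by (induction k) (simp_all add: mult_single algebra_simps)

lemma laurent_const_homomorphism:
  "ring_homomorphism (\<lambda>c. Poly_Mapping.single 0 (mconst c) :: 'k::comm_ring_1 laurent_mpol)"
  by (rule ring_homomorphism_comp[OF single_homomorphism mconst_homomorphism])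

section \<open>Bigraded pieces of a polynomial ring\<close>

lemma bihomogeneous_part_add:
  "f \<in> bihomogeneous_part Q D \<Longrightarrow> g \<in> bihomogeneous_part Q D \<Longrightarrow> f + g \<in> bihomogeneous_part Q D"
  by (simp add: bihomogeneous_part_def homogeneous_part_add)

lemma bihomogeneous_part_zero: "0 \<in> bihomogeneous_part Q D"
  by (simp add: bihomogeneous_part_def homogeneous_part_zero)

lemma bihomogeneous_part_mult:
  "f \<in> bihomogeneous_part Q D \<Longrightarrow> g \<in> bihomogeneous_part Q D' \<Longrightarrow> f * g \<in> bihomogeneous_part Q (D + D')"
  by (simp add: bihomogeneous_part_def homogeneous_part_mult)

lemma bihomogeneous_part_mconst: "mconst c \<in> bihomogeneous_part Q 0"
  by (simp add: bihomogeneous_part_def homogeneous_part_mconst)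

lemma bihomogeneous_part_mvar: "mvar v \<in> bihomogeneous_part Q (Q v)"
  using homogeneous_part_mvar[of v "fst \<circ> Q"] homogeneous_part_mvar[of v "snd \<circ> Q"]
  by (simp add: bihomogeneous_part_def)

text \<open>Up to sign, \<open>f1\<close>, \<open>f2\<close>, \<open>f3\<close> are the 2x2 minors
  of the matrix with rows (x, u, z) and (z, x, u w). Repeating a row gives the two linear syzygies;
  the three quadratic identities say that x, z and u multiply \<open>f4\<close> into the square of
  the ideal of minors.\<close>

lemma determinantal_syzygies:
  fixes x u w z :: "'a::comm_ring_1"
  defines "f1 \<equiv> x ^ 2 - u * z" and "f2 \<equiv> x * z - u ^ 2 * w" and "f3 \<equiv> x * u * w - z ^ 2"
  defines "f4 \<equiv> x * w * f1 - u * w * f2 - z * f3"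
  shows "w * f1 ^ 2 - f2 * f3 = x * f4" "u * w * f1 - z * f2 = x * f3"
    "z * f1 - x * f2 = u * f3" "f3 ^ 2 + w * f1 * f2 = z * f4" "f2 ^ 2 + f1 * f3 = u * f4"
  unfolding assms by (simp_all add: algebra_simps power2_eq_square)

text \<open>The triple is (3n + q, 3, 3n + 2q) with m = 1, so that 2(3n + q) = 3n + (3n + 2q), and
  the halved exponents of the relations become 0, 1, 2, q, n + q and 2n + q. The assumption on q
  says that the other two weights are prime to 3; it lets degrees modulo 3 separate the normal
  monomials.\<close>

locale monomial_curve =
  fixes n q :: nat
  assumes q_not_3: "\<not> 3 dvd q"
begin

text \<open>Keeps the parameter m = 1 in the form in which the abbreviations below state it.\<close>

declare One_nat_def [simp del]

definition F1 :: "(coord, 'k::comm_ring_1) mpol"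
  where "F1 = mvar Cx ^ 2 - mvar Cy ^ n * mvar Cz"

definition F2 :: "(coord, 'k::comm_ring_1) mpol"
  where "F2 = mvar Cx * mvar Cz - mvar Cy ^ (2 * n + q)"

definition F3 :: "(coord, 'k::comm_ring_1) mpol"
  where "F3 = mvar Cx * mvar Cy ^ (n + q) - mvar Cz ^ 2"

text \<open>The fourth relation sets s4 t equal to the same combination of s1, s2, s3; since these
  carry t^(-1), \<open>F4\<close> belongs with t^(-2). The formula shows only membership in the
  ideal of the point; multiplicity two comes from the quadratic syzygies.\<close>

definition F4 :: "(coord, 'k::comm_ring_1) mpol"
  where "F4 = mvar Cx * mvar Cy ^ q * F1 - mvar Cy ^ (n + q) * F2 - mvar Cz * F3"

abbreviation "weight \<equiv> coord_weight (3 * n + q) 3 (3 * n + 2 * q)"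
abbreviation "degree_of_gen \<equiv> gen_deg (3 * n + q) 3 (3 * n + 2 * q) n 1"
abbreviation "rels \<equiv> relations 3 (3 * n + 2 * q) n 1"
abbreviation "rel_ideal \<equiv> relation_ideal 3 (3 * n + 2 * q) n 1"
abbreviation "sat_rel_ideal \<equiv> saturated_relation_ideal 3 (3 * n + 2 * q) n 1"
abbreviation "pt_ideal \<equiv> point_ideal (3 * n + q) 3 (3 * n + 2 * q)"
abbreviation "symbolic \<equiv> saturated_power (3 * n + q) 3 (3 * n + 2 * q)"
abbreviation "component \<equiv> cox_component (3 * n + q) 3 (3 * n + 2 * q)"

fun gen_image :: "gen \<Rightarrow> 'k::comm_ring_1 laurent_mpol" where
  "gen_image Gx = Poly_Mapping.single 0 (mvar Cx)"
| "gen_image Gy = Poly_Mapping.single 0 (mvar Cy)"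
| "gen_image Gz = Poly_Mapping.single 0 (mvar Cz)"
| "gen_image Gs1 = Poly_Mapping.single (-1) F1"
| "gen_image Gs2 = Poly_Mapping.single (-1) F2"
| "gen_image Gs3 = Poly_Mapping.single (-1) F3"
| "gen_image Gs4 = Poly_Mapping.single (-2) F4"
| "gen_image Gt = Poly_Mapping.single 1 1"

definition rees_map :: "(gen, 'k::comm_ring_1) mpol \<Rightarrow> 'k laurent_mpol"
  where "rees_map = mpol_subst (\<lambda>c. Poly_Mapping.single 0 (mconst c)) gen_image"

lemma rees_map_homomorphism: "ring_homomorphism (rees_map :: (gen, 'k::comm_ring_1) mpol \<Rightarrow> _)"
  unfolding rees_map_def
  by (rule ring_homomorphism.mpol_subst_homomorphism[OF laurent_const_homomorphism])

lemma rees_map_mvar [simp]: "rees_map (mvar v) = gen_image v"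
  unfolding rees_map_def
  by (rule ring_homomorphism.mpol_subst_mvar[OF laurent_const_homomorphism])

lemma rees_map_mconst [simp]: "rees_map (mconst c) = Poly_Mapping.single 0 (mconst c)"
  unfolding rees_map_def
  by (rule ring_homomorphism.mpol_subst_mconst[OF laurent_const_homomorphism])

lemmas rees_map_simps = ring_homomorphism.hom_simps[OF rees_map_homomorphism]

lemma exponents:
  "(3 - 1) div 2 = (1::nat)" "(3 + 1) div 2 = (2::nat)" "(3 - 3 * 1) div 2 = (0::nat)"
  "(3 * n + 2 * q + n) div 2 = 2 * n + q" "(3 * n + 2 * q - n) div 2 = n + q"
  "(3 * n + 2 * q - 3 * n) div 2 = q"
  by auto

lemma rels_eq:
  "(rels :: (gen, 'k::comm_ring_1) mpol set) =
    (let x = mvar Gx; y = mvar Gy; z = mvar Gz;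
         s1 = mvar Gs1; s2 = mvar Gs2; s3 = mvar Gs3; s4 = mvar Gs4; t = mvar Gt
     in {x ^ 2 - y ^ n * z - s1 * t,
         x * z - y ^ (2 * n + q) - s2 * t,
         x * y ^ (n + q) - z ^ 2 - s3 * t,
         x * y ^ q * s1 - y ^ (n + q) * s2 - z * s3 - s4 * t,
         y ^ q * s1 ^ 2 - s2 * s3 - x * s4,
         y ^ (n + q) * s1 - z * s2 - x * s3,
         z * s1 - x * s2 - y ^ n * s3,
         s3 ^ 2 + y ^ q * s1 * s2 - z * s4,
         s2 ^ 2 + s1 * s3 - y ^ n * s4})"
  unfolding relations_def exponents Let_def by simp

lemma F_syzygies:
  "mvar Cy ^ q * F1 ^ 2 - F2 * F3 = mvar Cx * (F4 :: (coord, 'k::comm_ring_1) mpol)"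
  "mvar Cy ^ (n + q) * F1 - mvar Cz * F2 = mvar Cx * (F3 :: (coord, 'k) mpol)"
  "mvar Cz * F1 - mvar Cx * F2 = mvar Cy ^ n * (F3 :: (coord, 'k) mpol)"
  "F3 ^ 2 + mvar Cy ^ q * F1 * F2 = mvar Cz * (F4 :: (coord, 'k) mpol)"
  "F2 ^ 2 + F1 * F3 = mvar Cy ^ n * (F4 :: (coord, 'k) mpol)"
proof -
  let ?u = "mvar Cy ^ n :: (coord, 'k) mpol" and ?w = "mvar Cy ^ q :: (coord, 'k) mpol"
  have F: "F1 = mvar Cx ^ 2 - ?u * mvar Cz" "F2 = mvar Cx * mvar Cz - ?u ^ 2 * ?w"
      "F3 = mvar Cx * ?u * ?w - mvar Cz ^ 2"
    by (simp_all add: F1_def F2_def F3_def power_add mult_2 power2_eq_square mult.assoc)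
  have F': "F4 = mvar Cx * ?w * F1 - ?u * ?w * F2 - mvar Cz * F3"
    by (simp add: F4_def power_add)
  show "mvar Cy ^ q * F1 ^ 2 - F2 * F3 = mvar Cx * (F4 :: (coord, 'k) mpol)"
    "mvar Cy ^ (n + q) * F1 - mvar Cz * F2 = mvar Cx * (F3 :: (coord, 'k) mpol)"
    "mvar Cz * F1 - mvar Cx * F2 = mvar Cy ^ n * (F3 :: (coord, 'k) mpol)"
    "F3 ^ 2 + mvar Cy ^ q * F1 * F2 = mvar Cz * (F4 :: (coord, 'k) mpol)"
    "F2 ^ 2 + F1 * F3 = mvar Cy ^ n * (F4 :: (coord, 'k) mpol)"
    unfolding power_add F' unfolding F by (rule determinantal_syzygies)+
qed

text \<open>All terms of a relation carry the same power of t. The first four relations then restate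
  the definitions of \<open>F1\<close> to \<open>F4\<close>, and the other five are the
  syzygies.\<close>

lemma rees_map_rels:
  assumes "r \<in> rels" shows "rees_map (r :: (gen, 'k::comm_ring_1) mpol) = 0"
proof -
  have s: "Poly_Mapping.single i (a::(coord, 'k) mpol) + Poly_Mapping.single i b = Poly_Mapping.single i (a + b)"
    "Poly_Mapping.single i (a::(coord, 'k) mpol) - Poly_Mapping.single i b = Poly_Mapping.single i (a - b)"
    for i :: int and a b by (simp_all add: single_add single_diff)
  show ?thesis
    using assms unfolding rels_eq Let_def
    by (elim insertE emptyE)
      (simp_all add: rees_map_simps mult_single single_power s F_syzygies,
       simp_all add: F1_def F2_def F3_def F4_def)
qed

lemma rel_ideal_ideal: "ideal (rel_ideal :: (gen, 'k::comm_ring_1) mpol set) type_ring"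
  unfolding relation_ideal_def by (rule genideal_ideal)

lemma rels_subset: "(rels :: (gen, 'k::comm_ring_1) mpol set) \<subseteq> rel_ideal"
  unfolding relation_ideal_def by (rule genideal_supset)

lemma rees_map_rel_ideal:
  assumes "r \<in> rel_ideal" shows "rees_map (r :: (gen, 'k::comm_ring_1) mpol) = 0"
proof -
  have "rel_ideal \<subseteq> {r :: (gen, 'k) mpol. 0 dvd rees_map r}"
    unfolding relation_ideal_def
    by (rule genideal_subset_idealI[OF ideal_dvd_hom[OF rees_map_homomorphism]])
      (auto simp: rees_map_rels)
  then show ?thesis using assms by auto
qed

section \<open>Clearing denominators and the kernel\<close>

fun coord_gen :: "coord \<Rightarrow> gen" where
  "coord_gen Cx = Gx" | "coord_gen Cy = Gy" | "coord_gen Cz = Gz"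

definition lift_coord :: "(coord, 'k::comm_ring_1) mpol \<Rightarrow> (gen, 'k) mpol"
  where "lift_coord = mpol_subst mconst (\<lambda>v. mvar (coord_gen v))"

lemma lift_coord_homomorphism: "ring_homomorphism (lift_coord :: (coord, 'k::comm_ring_1) mpol \<Rightarrow> _)"
  unfolding lift_coord_def by (rule ring_homomorphism.mpol_subst_homomorphism[OF mconst_homomorphism])

lemma lift_coord_mvar [simp]: "lift_coord (mvar v) = mvar (coord_gen v)"
  unfolding lift_coord_def by (rule ring_homomorphism.mpol_subst_mvar[OF mconst_homomorphism])

lemma lift_coord_mconst [simp]: "lift_coord (mconst c) = mconst c"
  unfolding lift_coord_def by (rule ring_homomorphism.mpol_subst_mconst[OF mconst_homomorphism])

lemmas lift_coord_simps = ring_homomorphism.hom_simps[OF lift_coord_homomorphism]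

lemma rees_map_lift_coord:
  "rees_map (lift_coord f :: (gen, 'k::comm_ring_1) mpol) = Poly_Mapping.single 0 f"
proof (rule ring_homomorphism_eqI[where f = "\<lambda>f. rees_map (lift_coord f)"])
  show "ring_homomorphism (\<lambda>f. rees_map (lift_coord f :: (gen, 'k) mpol))"
    by (rule ring_homomorphism_comp[OF rees_map_homomorphism lift_coord_homomorphism])
  fix v
  show "rees_map (lift_coord (mvar v) :: (gen, 'k) mpol) = Poly_Mapping.single 0 (mvar v)"
    by (cases v) simp_all
qed (simp_all add: single_homomorphism)

text \<open>An element of \<K>[x,y,z][t], stored by powers of t, read as a polynomial in the
  generators that is free of s1, ..., s4. This is the form reached after clearing
  denominators.\<close>

definition lift_poly :: "(nat \<Rightarrow>\<^sub>0 (coord, 'k::comm_ring_1) mpol) \<Rightarrow> (gen, 'k) mpol"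
  where "lift_poly = linear_extension (\<lambda>i f. lift_coord f * mvar Gt ^ i)"

lemma lift_poly_single: "lift_poly (Poly_Mapping.single i f) = lift_coord f * mvar Gt ^ i"
  by (simp add: lift_poly_def linear_extension_single lift_coord_simps)

lemma lift_poly_homomorphism: "ring_homomorphism (lift_poly :: (nat \<Rightarrow>\<^sub>0 (coord, 'k::comm_ring_1) mpol) \<Rightarrow> _)"
proof
  fix p r :: "nat \<Rightarrow>\<^sub>0 (coord, 'k) mpol"
  show "lift_poly (p + r) = lift_poly p + lift_poly r"
    unfolding lift_poly_def
    by (rule linear_extension_add) (simp_all add: lift_coord_simps algebra_simps)
  show "lift_poly (p * r) = lift_poly p * lift_poly r"
    unfolding lift_poly_def
    by (rule linear_extension_mult) (simp_all add: lift_coord_simps algebra_simps power_add)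
  show "lift_poly (1 :: nat \<Rightarrow>\<^sub>0 (coord, 'k) mpol) = 1"
    by (subst single_one[symmetric], subst lift_poly_single) (simp add: lift_coord_simps)
qed

lemmas lift_poly_simps = ring_homomorphism.hom_simps[OF lift_poly_homomorphism]

text \<open>Polynomials in t embed into Laurent polynomials: the coefficient of t^i can be read off
  from the image.\<close>

lemma rees_map_lift_poly_inj:
  assumes "rees_map (lift_poly p :: (gen, 'k::comm_ring_1) mpol) = 0"
  shows "p = 0"
proof -
  have "Poly_Mapping.lookup (rees_map (lift_poly p :: (gen, 'k) mpol)) (int i) = Poly_Mapping.lookup p i" for i
  proof (induction p rule: poly_mapping_induct_add)
    case (single j b)
    then show ?case
      by (simp add: lift_poly_single rees_map_simps rees_map_lift_coord single_power mult_single
          lookup_single)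
  next
    case (add p r)
    then show ?case by (simp add: lift_poly_simps rees_map_simps lookup_add)
  qed
  then show ?thesis
    using assms by (intro poly_mapping_eqI) (metis lookup_zero)
qed

text \<open>The elements f for which some f t^N agrees, modulo the relations, with a polynomial free
  of s1, ..., s4 are closed under sums and products. They include all generators: s1 t, s2 t, s3 t
  are congruent to \<open>F1\<close>, \<open>F2\<close>, \<open>F3\<close>, and s4 t to an
  expression in the earlier generators.\<close>

lemma clear_denominator:
  fixes f :: "(gen, 'k::comm_ring_1) mpol"
  shows "\<exists>N p. f * mvar Gt ^ N - lift_poly p \<in> rel_ideal"
proof -
  let ?t = "mvar Gt :: (gen, 'k) mpol"
  have I: "0 \<in> (rel_ideal :: (gen, 'k) mpol set)" "x \<in> rel_ideal \<Longrightarrow> y \<in> rel_ideal \<Longrightarrow> x + y \<in> rel_ideal"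
    "x \<in> rel_ideal \<Longrightarrow> r * x \<in> rel_ideal" for x y r :: "(gen, 'k) mpol"
    using rel_ideal_ideal[unfolded ideal_type_ring_iff] by blast+
  have gen: "\<exists>N p. f * ?t ^ N - lift_poly p \<in> rel_ideal" if "r \<in> rels" "f * ?t ^ N = lift_poly p - r" for f r N p
  proof -
    have "f * ?t ^ N - lift_poly p = (- 1) * r" using that(2) by simp
    moreover have "\<dots> \<in> rel_ideal" using that(1) rels_subset I(3) by blast
    ultimately show ?thesis by metis
  qed
  have base: "\<exists>N p. f * ?t ^ N - lift_poly p \<in> rel_ideal" if "f * ?t ^ N = lift_poly p" for f N p
    using that I(1) by (metis diff_self)
  have mult_t: "\<exists>N p. f * ?t ^ N - lift_poly p \<in> rel_ideal"
    if "\<exists>N p. (f * ?t) * ?t ^ N - lift_poly p \<in> rel_ideal" for f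
    using that by (metis mult.assoc power_Suc)
  have add: "\<exists>N p. (f + g) * ?t ^ N - lift_poly p \<in> rel_ideal"
    if f: "\<exists>N p. f * ?t ^ N - lift_poly p \<in> rel_ideal" and g: "\<exists>N p. g * ?t ^ N - lift_poly p \<in> rel_ideal" for f g
  proof -
    obtain M p where p: "f * ?t ^ M - lift_poly p \<in> rel_ideal" using f by blast
    obtain N r where r: "g * ?t ^ N - lift_poly r \<in> rel_ideal" using g by blast
    \<comment> \<open>Passing to the common exponent M + N multiplies p by t^N and r by t^M.\<close>
    let ?s = "p * Poly_Mapping.single N 1 + r * Poly_Mapping.single M 1"
    have "(f + g) * ?t ^ (M + N) - lift_poly ?s =
        ?t ^ N * (f * ?t ^ M - lift_poly p) + ?t ^ M * (g * ?t ^ N - lift_poly r)"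
      by (simp add: lift_poly_simps lift_poly_single lift_coord_simps algebra_simps power_add)
    moreover have "\<dots> \<in> rel_ideal" by (intro I p r)
    ultimately show ?thesis by metis
  qed
  have mult: "\<exists>N p. (f * g) * ?t ^ N - lift_poly p \<in> rel_ideal"
    if f: "\<exists>N p. f * ?t ^ N - lift_poly p \<in> rel_ideal" and g: "\<exists>N p. g * ?t ^ N - lift_poly p \<in> rel_ideal" for f g
  proof -
    obtain M p where p: "f * ?t ^ M - lift_poly p \<in> rel_ideal" using f by blast
    obtain N r where r: "g * ?t ^ N - lift_poly r \<in> rel_ideal" using g by blast
    have "(f * g) * ?t ^ (M + N) - lift_poly (p * r) =
        (g * ?t ^ N) * (f * ?t ^ M - lift_poly p) + lift_poly p * (g * ?t ^ N - lift_poly r)"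
      by (simp add: lift_poly_simps algebra_simps power_add)
    moreover have "\<dots> \<in> rel_ideal" by (intro I p r)
    ultimately show ?thesis by metis
  qed
  have const: "\<exists>N p. mconst c * ?t ^ N - lift_poly p \<in> rel_ideal" for c
    by (rule base[of _ 0 "Poly_Mapping.single 0 (mconst c)"]) (simp add: lift_poly_single)
  have coord: "\<exists>N p. mvar (coord_gen v) * ?t ^ N - lift_poly p \<in> rel_ideal" for v
    by (rule base[of _ 0 "Poly_Mapping.single 0 (mvar v)"]) (simp add: lift_poly_single)
  have s1: "\<exists>N p. mvar Gs1 * ?t ^ N - lift_poly p \<in> rel_ideal"
    by (rule gen[of "mvar Gx ^ 2 - mvar Gy ^ n * mvar Gz - mvar Gs1 * ?t" _ 1 "Poly_Mapping.single 0 F1"])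
      (simp_all add: rels_eq Let_def lift_poly_single F1_def lift_coord_simps)
  have s2: "\<exists>N p. mvar Gs2 * ?t ^ N - lift_poly p \<in> rel_ideal"
    by (rule gen[of "mvar Gx * mvar Gz - mvar Gy ^ (2 * n + q) - mvar Gs2 * ?t" _ 1 "Poly_Mapping.single 0 F2"])
      (simp_all add: rels_eq Let_def lift_poly_single F2_def lift_coord_simps)
  have s3: "\<exists>N p. mvar Gs3 * ?t ^ N - lift_poly p \<in> rel_ideal"
    by (rule gen[of "mvar Gx * mvar Gy ^ (n + q) - mvar Gz ^ 2 - mvar Gs3 * ?t" _ 1 "Poly_Mapping.single 0 F3"])
      (simp_all add: rels_eq Let_def lift_poly_single F3_def lift_coord_simps)
  have neg: "\<exists>N p. (- f) * ?t ^ N - lift_poly p \<in> rel_ideal"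
    if "\<exists>N p. f * ?t ^ N - lift_poly p \<in> rel_ideal" for f
    using mult[OF const[of "- 1"] that] ring_homomorphism.hom_simps[OF mconst_homomorphism]
    by (metis mult_minus1)
  have pow: "\<exists>N p. (f ^ k) * ?t ^ N - lift_poly p \<in> rel_ideal"
    if "\<exists>N p. f * ?t ^ N - lift_poly p \<in> rel_ideal" for f k
  proof (induction k)
    case 0
    show ?case using const[of 1] ring_homomorphism.hom_one[OF mconst_homomorphism] by (metis power_0)
  next
    case (Suc k)
    then show ?case using mult[OF that Suc] by simp
  qed
  \<comment> \<open>Modulo the fourth relation s4 t becomes \<open>?g\<close>, which involves only
    generators already treated; \<open>mult_t\<close> absorbs the extra factor t.\<close>
  have s4: "\<exists>N p. mvar Gs4 * ?t ^ N - lift_poly p \<in> rel_ideal"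
  proof (rule mult_t)
    let ?g = "mvar Gx * mvar Gy ^ q * mvar Gs1 - mvar Gy ^ (n + q) * mvar Gs2 - mvar Gz * mvar Gs3 :: (gen, 'k) mpol"
    have "?g = (mvar Gx * mvar Gy ^ q) * mvar Gs1 + (- (mvar Gy ^ (n + q) * mvar Gs2) + - (mvar Gz * mvar Gs3))"
      by simp
    then have "\<exists>N p. ?g * ?t ^ N - lift_poly p \<in> rel_ideal"
      using coord[of Cx] coord[of Cy] coord[of Cz] s1 s2 s3
      by (simp only: coord_gen.simps) (intro add mult neg pow)
    then obtain N p where p: "?g * ?t ^ N - lift_poly p \<in> rel_ideal" by blast
    have "(mvar Gs4 * ?t) * ?t ^ N - lift_poly p
       = (?g * ?t ^ N - lift_poly p) + (- (?t ^ N)) * (?g - mvar Gs4 * ?t)"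
      by (simp add: algebra_simps)
    moreover have "?g - mvar Gs4 * ?t \<in> rel_ideal"
      using rels_subset by (auto simp: rels_eq Let_def)
    ultimately show "\<exists>N p. (mvar Gs4 * ?t) * ?t ^ N - lift_poly p \<in> rel_ideal"
      using p I by metis
  qed
  have t: "\<exists>N p. ?t * ?t ^ N - lift_poly p \<in> rel_ideal"
    by (rule base[of _ 0 "Poly_Mapping.single 1 1"]) (simp add: lift_poly_single lift_coord_simps)
  show ?thesis
  proof (induction f rule: mpol_induct)
    case (var v)
    show ?case
      using coord[of Cx] coord[of Cy] coord[of Cz] s1 s2 s3 s4 t by (cases v) simp_all
  qed (fact const add mult)+
qed

text \<open>Since t is invertible in the target, the saturation lies in the kernel. Conversely, for
  f in the kernel, clearing denominators leaves a polynomial in x, y, z, t with image 0, which is 0;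
  so f t^N is in the relation ideal.\<close>

theorem kernel_rees_map:
  "{f. rees_map f = 0} = (sat_rel_ideal :: (gen, 'k::comm_ring_1) mpol set)"
proof -
  have "rees_map f = 0 \<longleftrightarrow> (\<exists>N. f * mvar Gt ^ N \<in> rel_ideal)" for f :: "(gen, 'k) mpol"
  proof
    assume f: "rees_map f = 0"
    obtain N p where p: "f * mvar Gt ^ N - lift_poly p \<in> rel_ideal"
      using clear_denominator by blast
    from rees_map_rel_ideal[OF p] have "rees_map (lift_poly p :: (gen, 'k) mpol) = 0"
      by (simp add: rees_map_simps f)
    then have "p = 0" by (rule rees_map_lift_poly_inj)
    then show "\<exists>N. f * mvar Gt ^ N \<in> rel_ideal"
      using p by (auto simp: lift_poly_simps)
  next
    assume "\<exists>N. f * mvar Gt ^ N \<in> rel_ideal"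
    then obtain N where "f * mvar Gt ^ N \<in> rel_ideal" by blast
    from rees_map_rel_ideal[OF this]
    have "rees_map f * Poly_Mapping.single (int N) 1 = 0"
      by (simp add: rees_map_simps single_power)
    then have "rees_map f * Poly_Mapping.single (int N) 1 * Poly_Mapping.single (- int N) 1 = 0"
      by simp
    then show "rees_map f = 0" by (simp add: mult.assoc mult_single)
  qed
  then show ?thesis
    by (simp add: saturated_relation_ideal_def ideal_saturation_principal[OF rel_ideal_ideal])
qed

end

section \<open>The image lies in the saturated Rees algebra\<close>

text \<open>Stated for any multiplicative graded family C because it is applied to three of them:
  Cox components, multipliers that preserve \<open>reduced\<close>, and bihomogeneous parts.\<close>

lemma monomial_memI:
  fixes g :: "'v \<Rightarrow> 'r::comm_ring_1" and C :: "int \<times> int \<Rightarrow> 'r set"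
  assumes one: "1 \<in> C 0" and mult: "\<And>D D' f f'. f \<in> C D \<Longrightarrow> f' \<in> C D' \<Longrightarrow> f * f' \<in> C (D + D')"
    and gen: "\<And>v. g v \<in> C (Q v)"
  shows "eval_monomial g e \<in> C (monomial_deg (fst \<circ> Q) e, monomial_deg (snd \<circ> Q) e)"
proof -
  have pow: "g v ^ k \<in> C (int k * fst (Q v), int k * snd (Q v))" for v k
  proof (induction k)
    case 0
    then show ?case using one by (simp add: zero_prod_def)
  next
    case (Suc k)
    have "(int (Suc k) * fst (Q v), int (Suc k) * snd (Q v))
        = Q v + (int k * fst (Q v), int k * snd (Q v))"
      by (simp add: prod_eq_iff algebra_simps)
    then show ?case using mult[OF gen[of v] Suc] by (simp only: power_Suc)
  qed
  have "(\<Prod>v\<in>A. g v ^ Poly_Mapping.lookup e v) \<in>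
      C (\<Sum>v\<in>A. int (Poly_Mapping.lookup e v) * fst (Q v), \<Sum>v\<in>A. int (Poly_Mapping.lookup e v) * snd (Q v))"
    if "finite A" for A
    using that
  proof (induction A)
    case empty
    then show ?case using one by (simp add: zero_prod_def)
  next
    case (insert v A)
    then show ?case using mult[OF pow insert.IH] by simp
  qed
  then show ?thesis by (simp add: eval_monomial_def monomial_deg_def)
qed

context monomial_curve
begin

lemma F_homogeneous:
  "(F1 :: (coord, 'k::comm_ring_1) mpol) \<in> homogeneous_part weight (6 * int n + 2 * int q)"
  "(F2 :: (coord, 'k) mpol) \<in> homogeneous_part weight (6 * int n + 3 * int q)"
  "(F3 :: (coord, 'k) mpol) \<in> homogeneous_part weight (6 * int n + 4 * int q)"
  "(F4 :: (coord, 'k) mpol) \<in> homogeneous_part weight (9 * int n + 6 * int q)"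
proof -
  have eq: "f \<in> homogeneous_part weight d \<Longrightarrow> d = d' \<Longrightarrow> f \<in> homogeneous_part weight d'"
    for f :: "(coord, 'k) mpol" and d d' by simp
  note var = homogeneous_part_mvar[of Cx weight] homogeneous_part_mvar[of Cy weight]
    homogeneous_part_mvar[of Cz weight]
  note pow = homogeneous_part_power[OF var(2)]
  show F1: "(F1 :: (coord, 'k) mpol) \<in> homogeneous_part weight (6 * int n + 2 * int q)"
    unfolding F1_def
    by (intro homogeneous_part_diff; rule eq[OF homogeneous_part_power[OF var(1)]]
        eq[OF homogeneous_part_mult[OF pow var(3)]]) simp_all
  show F2: "(F2 :: (coord, 'k) mpol) \<in> homogeneous_part weight (6 * int n + 3 * int q)"
    unfolding F2_def
    by (intro homogeneous_part_diff; rule eq[OF homogeneous_part_mult[OF var(1,3)]] eq[OF pow]) simp_all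
  show F3: "(F3 :: (coord, 'k) mpol) \<in> homogeneous_part weight (6 * int n + 4 * int q)"
    unfolding F3_def
    by (intro homogeneous_part_diff; rule eq[OF homogeneous_part_power[OF var(3)]]
        eq[OF homogeneous_part_mult[OF var(1) pow]]) simp_all
  show "(F4 :: (coord, 'k) mpol) \<in> homogeneous_part weight (9 * int n + 6 * int q)"
    unfolding F4_def
    by (intro homogeneous_part_diff; rule eq[OF homogeneous_part_mult[OF homogeneous_part_mult[OF var(1) pow] F1]]
        eq[OF homogeneous_part_mult[OF pow F2]] eq[OF homogeneous_part_mult[OF var(3) F3]]) simp_all
qed

lemma pt_ideal_ideal: "ideal (pt_ideal :: (coord, 'k::comm_ring_1) mpol set) type_ring"
  unfolding point_ideal_def by (rule genideal_ideal)

lemma F_mem_pt_ideal: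
  "(F1 :: (coord, 'k::comm_ring_1) mpol) \<in> pt_ideal"
  "(F2 :: (coord, 'k::comm_ring_1) mpol) \<in> pt_ideal"
  "(F3 :: (coord, 'k::comm_ring_1) mpol) \<in> pt_ideal"
proof -
  note e = ring_homomorphism.hom_simps[OF mpol_eval_homomorphism] mpol_eval_mvar
  have "mpol_eval (\<lambda>_. 1) (F1 :: (coord, 'k) mpol) = 0" "mpol_eval (\<lambda>_. 1) (F2 :: (coord, 'k) mpol) = 0"
    "mpol_eval (\<lambda>_. 1) (F3 :: (coord, 'k) mpol) = 0"
    by (simp_all add: F1_def F2_def F3_def e)
  then have "{F1, F2, F3 :: (coord, 'k) mpol} \<subseteq> pt_ideal"
    unfolding point_ideal_def
    by (intro subset_trans[OF _ genideal_supset]) (auto intro: F_homogeneous)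
  then show "(F1 :: (coord, 'k) mpol) \<in> pt_ideal" "(F2 :: (coord, 'k) mpol) \<in> pt_ideal"
    "(F3 :: (coord, 'k) mpol) \<in> pt_ideal" by blast+
qed

lemma symbolic_ideal: "ideal (symbolic k :: (coord, 'k::comm_ring_1) mpol set) type_ring"
  unfolding saturated_power_def
  by (intro ideal_saturation_ideal ideal_power_ideal pt_ideal_ideal irrelevant_ideal_ideal)

lemma symbolic_nonpos: "k \<le> 0 \<Longrightarrow> symbolic k = (UNIV :: (coord, 'k::comm_ring_1) mpol set)"
  by (simp add: saturated_power_def ideal_saturation_def)

lemma symbolic_mult:
  assumes "f \<in> symbolic k" "g \<in> symbolic l"
  shows "f * g \<in> (symbolic (k + l) :: (coord, 'k::comm_ring_1) mpol set)"
proof -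
  have "f * g \<in> ideal_saturation type_ring (ideal_power type_ring pt_ideal (nat k + nat l)) irrelevant_ideal"
    using assms unfolding saturated_power_def
    by (rule ideal_saturation_mult[OF pt_ideal_ideal irrelevant_ideal_ideal])
  also have "\<dots> \<subseteq> symbolic (k + l)"
    unfolding saturated_power_def
    by (rule ideal_saturation_mono[OF ideal_power_antimono[OF pt_ideal_ideal]]) simp
  finally show ?thesis .
qed

lemma pt_ideal_subset_symbolic:
  assumes "f \<in> pt_ideal" shows "f \<in> (symbolic 1 :: (coord, 'k::comm_ring_1) mpol set)"
proof -
  have "g * f \<in> ideal_power type_ring pt_ideal 1" for g
    using mem_ideal_power_one[OF assms] ideal_power_ideal[OF pt_ideal_ideal[where 'k = 'k], of 1]
    unfolding ideal_type_ring_iff by blast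
  then have "f * g \<in> ideal_power type_ring pt_ideal (nat 1)" for g
    by (simp only: mult.commute[of f] nat_one_as_int[symmetric])
  then show ?thesis by (auto simp: saturated_power_def ideal_saturation_def)
qed

text \<open>The quadratic syzygies write x \<open>F4\<close>, z \<open>F4\<close> and y^n
  \<open>F4\<close> as quadratic expressions in \<open>F1\<close>, \<open>F2\<close>,
  \<open>F3\<close>, which is what the saturation criterion asks for with N = n.\<close>

lemma F4_mem_symbolic: "(F4 :: (coord, 'k::comm_ring_1) mpol) \<in> symbolic 2"
proof -
  let ?I = "ideal_power type_ring pt_ideal 2 :: (coord, 'k) mpol set"
  have I: "ideal ?I type_ring" by (rule ideal_power_ideal[OF pt_ideal_ideal])
  have mult: "f * g \<in> ?I" if "f \<in> pt_ideal" "g \<in> pt_ideal" for f g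
    using ideal_power_mult_mem[OF pt_ideal_ideal mem_ideal_power_one[OF that(1)] mem_ideal_power_one[OF that(2)]]
    by (simp only: one_add_one)
  have add: "f + g \<in> ?I" if "f \<in> ?I" "g \<in> ?I" for f g
    using I that by (auto simp: ideal_type_ring_iff)
  have scale: "r * f \<in> ?I" if "f \<in> ?I" for f r
    using I that by (auto simp: ideal_type_ring_iff)
  note F = F_mem_pt_ideal[where 'k = 'k]
  have "mvar Cx * F4 = mvar Cy ^ q * (F1 * F1) + (- 1) * (F2 * F3 :: (coord, 'k) mpol)"
    using F_syzygies(1)[where 'k = 'k] by (simp add: power2_eq_square)
  then have "mvar Cx * F4 \<in> ?I"
    using add[OF scale[OF mult[OF F(1,1)]] scale[OF mult[OF F(2,3)]]] by (simp only:)
  moreover have "mvar Cz * F4 = F3 * F3 + mvar Cy ^ q * (F1 * F2 :: (coord, 'k) mpol)"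
    using F_syzygies(4)[where 'k = 'k] by (simp add: power2_eq_square mult.assoc)
  then have "mvar Cz * F4 \<in> ?I"
    using add[OF mult[OF F(3,3)] scale[OF mult[OF F(1,2)]]] by (simp only:)
  moreover have "mvar Cy ^ n * F4 = F2 * F2 + (F1 * F3 :: (coord, 'k) mpol)"
    using F_syzygies(5)[where 'k = 'k] by (simp add: power2_eq_square)
  then have "mvar Cy ^ n * F4 \<in> ?I"
    using add[OF mult[OF F(2,2)] mult[OF F(1,3)]] by (simp only:)
  ultimately have "F4 * mvar Cx \<in> ?I" "F4 * mvar Cy ^ n \<in> ?I" "F4 * mvar Cz \<in> ?I"
    by (simp_all only: mult.commute)
  then have "F4 \<in> ideal_saturation type_ring ?I irrelevant_ideal"
    by (rule mem_irrelevant_saturationI[OF I])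
  then show ?thesis
    unfolding saturated_power_def by (simp only: nat_numeral)
qed

section \<open>The graded components of the Cox ring contain the image\<close>

lemma component_iff:
  "f \<in> component D \<longleftrightarrow> (\<exists>g. f = Poly_Mapping.single (snd D) g \<and> g \<in> symbolic (- snd D) \<and>
     g \<in> homogeneous_part weight (fst D))"
  by (auto simp: cox_component_def)

lemma component_mult:
  assumes "f \<in> component D" "g \<in> component D'"
  shows "f * g \<in> (component (D + D') :: 'k::comm_ring_1 laurent_mpol set)"
proof -
  obtain f' g' where f: "f = Poly_Mapping.single (snd D) f'" "f' \<in> symbolic (- snd D)"
      "f' \<in> homogeneous_part weight (fst D)"
    and g: "g = Poly_Mapping.single (snd D') g'" "g' \<in> symbolic (- snd D')"
      "g' \<in> homogeneous_part weight (fst D')"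
    using assms unfolding component_iff by blast
  show ?thesis unfolding component_iff
    using f g symbolic_mult[OF f(2) g(2)]
    by (intro exI[of _ "f' * g'"]) (simp add: mult_single homogeneous_part_mult)
qed

lemma component_add:
  assumes "f \<in> component D" "g \<in> component D"
  shows "f + g \<in> (component D :: 'k::comm_ring_1 laurent_mpol set)"
proof -
  obtain f' g' where f: "f = Poly_Mapping.single (snd D) f'" "f' \<in> symbolic (- snd D)"
      "f' \<in> homogeneous_part weight (fst D)"
    and g: "g = Poly_Mapping.single (snd D) g'" "g' \<in> symbolic (- snd D)"
      "g' \<in> homogeneous_part weight (fst D)"
    using assms unfolding component_iff by blast
  show ?thesis unfolding component_iff
    using f g symbolic_ideal[of "- snd D", where 'k = 'k]
    by (intro exI[of _ "f' + g'"]) (simp add: single_add homogeneous_part_add ideal_type_ring_iff)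
qed

lemma component_zero: "0 \<in> (component D :: 'k::comm_ring_1 laurent_mpol set)"
  unfolding component_iff using symbolic_ideal[of "- snd D", where 'k = 'k]
  by (intro exI[of _ 0]) (simp add: homogeneous_part_zero ideal_type_ring_iff)

lemma component_const: "Poly_Mapping.single 0 (mconst c) \<in> (component 0 :: 'k::comm_ring_1 laurent_mpol set)"
  unfolding component_iff
  by (intro exI[of _ "mconst c"]) (simp add: homogeneous_part_mconst symbolic_nonpos)

lemma component_singleI:
  assumes "g \<in> symbolic k" "g \<in> homogeneous_part weight d" "D = (d, \<mu>)" "k = - \<mu>"
  shows "Poly_Mapping.single \<mu> g \<in> (component D :: 'k::comm_ring_1 laurent_mpol set)"
  using assms unfolding component_iff by auto

lemma degree_of_gen_eqs:
  "degree_of_gen Gx = (3 * int n + int q, 0)" "degree_of_gen Gy = (3, 0)"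
  "degree_of_gen Gz = (3 * int n + 2 * int q, 0)" "degree_of_gen Gs1 = (6 * int n + 2 * int q, -1)"
  "degree_of_gen Gs2 = (6 * int n + 3 * int q, -1)" "degree_of_gen Gs3 = (6 * int n + 4 * int q, -1)"
  "degree_of_gen Gs4 = (9 * int n + 6 * int q, -2)" "degree_of_gen Gt = (0, 1)"
proof -
  have "3 * (3 * n + 2 * q + n) div 2 = 6 * n + 3 * q" "(3 * n + 2 * q) * (3 + 1) div 2 = 6 * n + 4 * q"
    by presburger+
  then show "degree_of_gen Gs2 = (6 * int n + 3 * int q, -1)" "degree_of_gen Gs3 = (6 * int n + 4 * int q, -1)"
    by (simp_all only: gen_deg.simps) simp_all
qed simp_all

lemma gen_image_component: "gen_image v \<in> (component (degree_of_gen v) :: 'k::comm_ring_1 laurent_mpol set)"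
proof -
  note var = homogeneous_part_mvar[of _ weight]
  note sym = pt_ideal_subset_symbolic[OF F_mem_pt_ideal(1)] pt_ideal_subset_symbolic[OF F_mem_pt_ideal(2)]
    pt_ideal_subset_symbolic[OF F_mem_pt_ideal(3)] F4_mem_symbolic
  have u: "g \<in> symbolic 0" "g \<in> symbolic (- 1)" for g :: "(coord, 'k) mpol"
    by (simp_all add: symbolic_nonpos)
  show ?thesis
  proof (cases v)
    case Gx
    show ?thesis unfolding Gx gen_image.simps
      by (rule component_singleI[OF u(1) var]) (simp_all add: degree_of_gen_eqs)
  next
    case Gy
    show ?thesis unfolding Gy gen_image.simps
      by (rule component_singleI[OF u(1) var]) (simp_all add: degree_of_gen_eqs)
  next
    case Gz
    show ?thesis unfolding Gz gen_image.simps
      by (rule component_singleI[OF u(1) var]) (simp_all add: degree_of_gen_eqs)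
  next
    case Gs1
    show ?thesis unfolding Gs1 gen_image.simps
      by (rule component_singleI[OF sym(1) F_homogeneous(1)]) (simp_all add: degree_of_gen_eqs)
  next
    case Gs2
    show ?thesis unfolding Gs2 gen_image.simps
      by (rule component_singleI[OF sym(2) F_homogeneous(2)]) (simp_all add: degree_of_gen_eqs)
  next
    case Gs3
    show ?thesis unfolding Gs3 gen_image.simps
      by (rule component_singleI[OF sym(3) F_homogeneous(3)]) (simp_all add: degree_of_gen_eqs)
  next
    case Gs4
    show ?thesis unfolding Gs4 gen_image.simps
      by (rule component_singleI[OF sym(4) F_homogeneous(4)]) (simp_all add: degree_of_gen_eqs)
  next
    case Gt
    show ?thesis unfolding Gt gen_image.simps
      by (rule component_singleI[OF u(2) homogeneous_part_one]) (simp_all add: degree_of_gen_eqs)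
  qed
qed

lemma rees_map_component:
  assumes f: "f \<in> bihomogeneous_part degree_of_gen D"
  shows "rees_map f \<in> (component D :: 'k::comm_ring_1 laurent_mpol set)"
proof -
  have m: "eval_monomial gen_image e \<in> component (monomial_deg (fst \<circ> degree_of_gen) e, monomial_deg (snd \<circ> degree_of_gen) e)"
    for e
    using component_const[of 1]
    by (intro monomial_memI component_mult gen_image_component)
       (simp_all add: ring_homomorphism.hom_one[OF mconst_homomorphism])
  have t: "Poly_Mapping.single 0 (mconst (Poly_Mapping.lookup f e)) * eval_monomial gen_image e \<in> component D"
    if "e \<in> Poly_Mapping.keys f" for e
  proof -
    have "(monomial_deg (fst \<circ> degree_of_gen) e, monomial_deg (snd \<circ> degree_of_gen) e) = D"
      using f that by (simp add: bihomogeneous_part_def homogeneous_part_def prod_eq_iff)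
    then show ?thesis
      using component_mult[OF component_const m] by (metis add_0)
  qed
  have "(\<Sum>e\<in>A. Poly_Mapping.single 0 (mconst (Poly_Mapping.lookup f e)) * eval_monomial gen_image e) \<in> component D"
    if "finite A" "A \<subseteq> Poly_Mapping.keys f" for A
    using that by (induction A) (auto simp: component_zero intro!: component_add t)
  then show ?thesis
    by (simp add: rees_map_def mpol_subst_def linear_extension_def)
qed

end

section \<open>Restriction to a generic line through the point\<close>

text \<open>Uniqueness of the expansion in powers of Q with digits of degree below deg Q: the lowest
  digit is divisible by Q and of smaller degree, hence 0. Dividing by Q shifts the remaining digits
  down by one.\<close>

lemma adic_expansion_zero:
  fixes Q :: "'k::field poly"
  assumes "degree Q = d" "d > 0" "(\<Sum>l\<le>B. Q ^ l * L l) = 0" "\<And>l. L l = 0 \<or> degree (L l) < d" "l \<le> B"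
  shows "L l = 0"
  using assms(3,4,5)
proof (induction B arbitrary: L l)
  case 0
  then show ?case by simp
next
  case (Suc B)
  have split: "(\<Sum>l\<le>Suc B. Q ^ l * L l) = L 0 + Q * (\<Sum>l\<le>B. Q ^ l * L (Suc l))"
    by (simp only: sum.atMost_Suc_shift) (simp add: sum_distrib_left mult.assoc)
  have Q: "Q \<noteq> 0" using assms(1,2) by auto
  have "Q dvd L 0"
    using Suc.prems(1) unfolding split by (metis dvd_triv_left dvd_0_right dvd_add_left_iff)
  then have L0: "L 0 = 0"
    using Suc.prems(2)[of 0] assms(1) Polynomial.dvd_imp_degree_le[of Q "L 0"] by linarith
  then have "(\<Sum>l\<le>B. Q ^ l * L (Suc l)) = 0"
    using Suc.prems(1) Q unfolding split by simp
  from Suc.IH[OF this] Suc.prems(2,3) L0 show ?case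
    by (cases l) auto
qed

text \<open>The relations at y = 1, t = \<tau>. Here \<open>s1\<close>, \<open>s2\<close>,
  \<open>s3\<close> are the quotients by \<tau>, and \<open>s4\<close> the quotient by \<tau>^2, of
  the restrictions of the corresponding polynomials to the line.\<close>

lemma specialised_relations:
  fixes \<alpha> \<gamma> \<tau> :: "'a::comm_ring_1"
  defines "x \<equiv> 1 + \<tau> * \<alpha>" and "z \<equiv> 1 + \<tau> * \<gamma>"
  defines "s1 \<equiv> 2 * \<alpha> - \<gamma> + \<tau> * \<alpha> ^ 2" and "s2 \<equiv> \<alpha> + \<gamma> + \<tau> * \<alpha> * \<gamma>"
    and "s3 \<equiv> \<alpha> - 2 * \<gamma> - \<tau> * \<gamma> ^ 2"
    and "s4 \<equiv> 3 * (\<alpha> ^ 2 - \<alpha> * \<gamma> + \<gamma> ^ 2) + \<tau> * (\<alpha> ^ 3 + \<gamma> ^ 3)"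
  shows "x ^ 2 - z - s1 * \<tau> = 0" "x * z - 1 - s2 * \<tau> = 0" "x - z ^ 2 - s3 * \<tau> = 0"
    "x * s1 - s2 - z * s3 - s4 * \<tau> = 0" "s1 ^ 2 - s2 * s3 - x * s4 = 0" "s1 - z * s2 - x * s3 = 0"
    "z * s1 - x * s2 - s3 = 0" "s3 ^ 2 + s1 * s2 - z * s4 = 0" "s2 ^ 2 + s1 * s3 - s4 = 0"
  unfolding assms by (simp_all add: algebra_simps power2_eq_square power3_eq_cube)

context monomial_curve
begin

text \<open>The relations hold for arbitrary \<open>\<alpha>\<close> and \<open>\<gamma>\<close>; the choice \<open>\<alpha> = (1 + v)/3\<close>, \<open>\<gamma> = (2v - 1)/3\<close> makes the
  leading coefficients \<open>2\<alpha> - \<gamma>\<close> of \<open>s\<^sub>1\<close> and \<open>\<alpha> + \<gamma>\<close> of \<open>s\<^sub>2\<close> equal to \<open>1\<close> and \<open>v\<close>. The outer polynomial variable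
  is \<open>\<tau>\<close>, the inner one \<open>v\<close>.\<close>

fun spec_image :: "gen \<Rightarrow> 'k::field_char_0 poly poly" where
  "spec_image Gx = 1 + [:0, 1:] * [:[:1/3, 1/3:]:]"
| "spec_image Gy = 1"
| "spec_image Gz = 1 + [:0, 1:] * [:[:-1/3, 2/3:]:]"
| "spec_image Gs1 = 2 * [:[:1/3, 1/3:]:] - [:[:-1/3, 2/3:]:] + [:0, 1:] * [:[:1/3, 1/3:]:] ^ 2"
| "spec_image Gs2 = [:[:1/3, 1/3:]:] + [:[:-1/3, 2/3:]:] + [:0, 1:] * [:[:1/3, 1/3:]:] * [:[:-1/3, 2/3:]:]"
| "spec_image Gs3 = [:[:1/3, 1/3:]:] - 2 * [:[:-1/3, 2/3:]:] - [:0, 1:] * [:[:-1/3, 2/3:]:] ^ 2"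
| "spec_image Gs4 = 3 * ([:[:1/3, 1/3:]:] ^ 2 - [:[:1/3, 1/3:]:] * [:[:-1/3, 2/3:]:] + [:[:-1/3, 2/3:]:] ^ 2)
     + [:0, 1:] * ([:[:1/3, 1/3:]:] ^ 3 + [:[:-1/3, 2/3:]:] ^ 3)"
| "spec_image Gt = [:0, 1:]"

definition spec :: "(gen, 'k::field_char_0) mpol \<Rightarrow> 'k poly poly"
  where "spec = mpol_subst (\<lambda>c. [:[:c:]:]) spec_image"

lemma poly_const_homomorphism: "ring_homomorphism (\<lambda>c. [:c:] :: 'a::comm_ring_1 poly)"
  by unfold_locales (simp_all add: one_pCons)

lemma spec_homomorphism: "ring_homomorphism (spec :: (gen, 'k::field_char_0) mpol \<Rightarrow> _)"
  and spec_mvar: "spec (mvar v) = (spec_image v :: 'k poly poly)"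
  and spec_mconst: "spec (mconst c) = [:[:c::'k:]:]"
proof -
  have *: "ring_homomorphism (\<lambda>c::'k. [:[:c:]:])"
    by (rule ring_homomorphism_comp[OF poly_const_homomorphism poly_const_homomorphism])
  show "ring_homomorphism (spec :: (gen, 'k) mpol \<Rightarrow> _)" "spec (mvar v) = (spec_image v :: 'k poly poly)"
    "spec (mconst c) = [:[:c::'k:]:]"
    unfolding spec_def
    by (simp_all add: ring_homomorphism.mpol_subst_homomorphism[OF *] ring_homomorphism.mpol_subst_mvar[OF *]
        ring_homomorphism.mpol_subst_mconst[OF *])
qed

lemmas spec_simps = ring_homomorphism.hom_simps[OF spec_homomorphism]

lemma spec_rels:
  assumes "r \<in> rels" shows "spec (r :: (gen, 'k::field_char_0) mpol) = 0"
  using assms unfolding rels_eq Let_def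
  by (elim insertE emptyE, simp_all only: spec_simps spec_mvar spec_image.simps power_one mult_1_left mult_1_right)
    (rule specialised_relations)+

text \<open>Since \<open>spec\<close> kills the relations, it kills f t^N for f in the saturation; t
  goes to \<tau>, a nonzero element of a domain, so f is killed too. Thus \<open>spec\<close>
  depends only on the image under \<open>rees_map\<close>.\<close>

lemma spec_kernel_rees_map:
  assumes "rees_map f = 0" shows "spec (f :: (gen, 'k::field_char_0) mpol) = 0"
proof -
  have "rel_ideal \<subseteq> {r :: (gen, 'k) mpol. 0 dvd spec r}"
    unfolding relation_ideal_def
    by (rule genideal_subset_idealI[OF ideal_dvd_hom[OF spec_homomorphism]]) (auto simp: spec_rels)
  moreover obtain N where "f * mvar Gt ^ N \<in> rel_ideal"
    using assms kernel_rees_map[where 'k = 'k]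
    by (auto simp: saturated_relation_ideal_def ideal_saturation_principal[OF rel_ideal_ideal])
  ultimately have "spec (f * mvar Gt ^ N) = 0" by auto
  then show ?thesis by (simp add: spec_simps spec_mvar)
qed

lemma spec_cong:
  assumes "rees_map f = rees_map g" shows "spec f = spec (g :: (gen, 'k::field_char_0) mpol)"
  using spec_kernel_rees_map[of "f - g"] assms by (simp add: rees_map_simps spec_simps)

text \<open>If the image of F is f t^(-k) with k nonnegative, this is the coefficient of \<tau>^k in
  the restriction of f to the line, a polynomial in v.\<close>

definition spec0 :: "(gen, 'k::field_char_0) mpol \<Rightarrow> 'k poly"
  where "spec0 f = poly (spec f) 0"

lemma spec0_homomorphism: "ring_homomorphism (spec0 :: (gen, 'k::field_char_0) mpol \<Rightarrow> _)"
  by unfold_locales (simp_all add: spec0_def spec_simps)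

lemmas spec0_simps = ring_homomorphism.hom_simps[OF spec0_homomorphism]

lemma spec0_mconst: "spec0 (mconst c) = [:c:]"
  by (simp add: spec0_def spec_mconst)

lemma spec0_mvar:
  "spec0 (mvar Gx) = (1 :: 'k::field_char_0 poly)" "spec0 (mvar Gy) = (1 :: 'k poly)"
  "spec0 (mvar Gz) = (1 :: 'k poly)" "spec0 (mvar Gs1) = (1 :: 'k poly)"
  "spec0 (mvar Gs2) = ([:0, 1:] :: 'k poly)" "spec0 (mvar Gs3) = ([:1, -1:] :: 'k poly)"
  "spec0 (mvar Gs4) = ([:1, -1, 1:] :: 'k poly)" "spec0 (mvar Gt) = (0 :: 'k poly)"
  by (simp_all add: spec0_def spec_mvar one_pCons numeral_poly power2_eq_square)

lemma spec_dvd_iff: "[:0, 1:] dvd spec f \<longleftrightarrow> spec0 f = 0"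
  using poly_eq_0_iff_dvd[of "spec f" 0] by (simp add: spec0_def)

text \<open>The variable y lies in the irrelevant ideal and restricts to 1, so the saturation does
  no harm; it remains to see that the ideal of the point restricts to multiples of \<tau>.\<close>

lemma symbolic_spec:
  assumes f: "f \<in> symbolic (int k)"
  shows "[:0, 1:] ^ k dvd spec (lift_coord (f :: (coord, 'k::field_char_0) mpol))"
proof (rule power_dvd_hom_ideal_saturation[where \<Psi> = "\<lambda>f. spec (lift_coord f)" and y = "mvar Cy"])
  show hom: "ring_homomorphism (\<lambda>f. spec (lift_coord (f :: (coord, 'k) mpol)))"
    by (rule ring_homomorphism_comp[OF spec_homomorphism lift_coord_homomorphism])
  show "f \<in> ideal_saturation type_ring (ideal_power type_ring pt_ideal k) irrelevant_ideal"
    using f by (simp add: saturated_power_def)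
  show "(mvar Cy :: (coord, 'k) mpol) \<in> irrelevant_ideal"
    by (rule mvar_mem_irrelevant_ideal)
  show "spec (lift_coord (mvar Cy :: (coord, 'k) mpol)) = 1"
    by (simp add: spec_mvar)
  \<comment> \<open>The line passes through (1,1,1) at \<tau> = 0, so the constant term is the value
    at that point.\<close>
  have "spec0 (lift_coord g) = [:mpol_eval (\<lambda>_. 1) g:]" for g :: "(coord, 'k) mpol"
  proof (rule ring_homomorphism_eqI[where f = "\<lambda>g. spec0 (lift_coord g)"])
    show "ring_homomorphism (\<lambda>g. spec0 (lift_coord (g :: (coord, 'k) mpol)))"
      by (rule ring_homomorphism_comp[OF spec0_homomorphism lift_coord_homomorphism])
    show "ring_homomorphism (\<lambda>g. [:mpol_eval (\<lambda>_. 1) (g :: (coord, 'k) mpol):])"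
      by (rule ring_homomorphism_comp[OF poly_const_homomorphism mpol_eval_homomorphism])
    fix v
    show "spec0 (lift_coord (mvar v :: (coord, 'k) mpol)) = [:mpol_eval (\<lambda>_. 1) (mvar v):]"
      by (cases v) (simp_all add: spec0_mvar mpol_eval_mvar one_pCons)
  qed (simp add: spec0_mconst mpol_eval_mconst)
  then have "pt_ideal \<subseteq> {g :: (coord, 'k) mpol. [:0, 1:] dvd spec (lift_coord g)}"
    unfolding point_ideal_def
    by (intro genideal_subset_idealI[OF ideal_dvd_hom[OF hom]]) (auto simp: spec_dvd_iff)
  then show "[:0, 1:] dvd spec (lift_coord g)" if "g \<in> pt_ideal" for g :: "(coord, 'k) mpol"
    using that by blast
qed

end

section \<open>Normal monomials span the image modulo \<open>t\<close>\<close>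

text \<open>A finite type of labels, so that a combination of normal monomials can be written as a
  sum over all labels.\<close>

datatype basis = B1 | B2 | B3 | BX1 | BX2 | BX3 | BZ

lemma UNIV_basis: "UNIV = {B1, B2, B3, BX1, BX2, BX3, BZ}"
  using basis.exhaust by auto

instance basis :: finite
  by standard (simp add: UNIV_basis)

context monomial_curve
begin

fun basis_elem :: "basis \<Rightarrow> (gen, 'k::comm_ring_1) mpol" where
  "basis_elem B1 = 1"
| "basis_elem B2 = mvar Gs2"
| "basis_elem B3 = mvar Gs3"
| "basis_elem BX1 = mvar Gx"
| "basis_elem BX2 = mvar Gx * mvar Gs2"
| "basis_elem BX3 = mvar Gx * mvar Gs3"
| "basis_elem BZ = mvar Gz"

fun basis_deg :: "basis \<Rightarrow> int \<times> int" where
  "basis_deg B1 = (0, 0)"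
| "basis_deg B2 = (6 * int n + 3 * int q, -1)"
| "basis_deg B3 = (6 * int n + 4 * int q, -1)"
| "basis_deg BX1 = (3 * int n + int q, 0)"
| "basis_deg BX2 = (9 * int n + 4 * int q, -1)"
| "basis_deg BX3 = (9 * int n + 5 * int q, -1)"
| "basis_deg BZ = (3 * int n + 2 * int q, 0)"

definition normal_monomial :: "nat \<Rightarrow> nat \<Rightarrow> nat \<Rightarrow> basis \<Rightarrow> (gen, 'k::comm_ring_1) mpol"
  where "normal_monomial j l i \<beta> = mvar Gy ^ j * mvar Gs4 ^ l * mvar Gs1 ^ i * basis_elem \<beta>"

definition normal_deg :: "nat \<Rightarrow> nat \<Rightarrow> nat \<Rightarrow> basis \<Rightarrow> int \<times> int"
  where "normal_deg j l i \<beta> =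
    (3 * int j + (9 * int n + 6 * int q) * int l + (6 * int n + 2 * int q) * int i, - (2 * int l) + - int i) + basis_deg \<beta>"

text \<open>The candidate for the Cox component of degree D.\<close>

definition rees_part :: "int \<times> int \<Rightarrow> 'k::comm_ring_1 laurent_mpol set"
  where "rees_part D = rees_map ` bihomogeneous_part degree_of_gen D"

lemma rees_part_mult: "f \<in> rees_part D \<Longrightarrow> g \<in> rees_part D' \<Longrightarrow> f * g \<in> rees_part (D + D')"
  unfolding rees_part_def by (force simp: rees_map_simps[symmetric] intro: bihomogeneous_part_mult)

lemma rees_part_gen: "gen_image v \<in> rees_part (degree_of_gen v)"
  unfolding rees_part_def by (rule image_eqI[where x = "mvar v"]) (simp_all add: bihomogeneous_part_mvar)

lemma rees_part_const: "Poly_Mapping.single 0 (mconst c) \<in> rees_part 0"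
  unfolding rees_part_def by (rule image_eqI[where x = "mconst c"]) (simp_all add: bihomogeneous_part_mconst)

lemma rees_part_add: "f \<in> rees_part D \<Longrightarrow> g \<in> rees_part D \<Longrightarrow> f + g \<in> rees_part D"
  unfolding rees_part_def by (force simp: rees_map_simps[symmetric] intro: bihomogeneous_part_add)

lemma rees_part_zero: "0 \<in> rees_part D"
  unfolding rees_part_def by (rule image_eqI[OF _ bihomogeneous_part_zero]) (simp add: rees_map_simps)

text \<open>Normal forms modulo t. The label \<open>BZ\<close> occurs only without s1, because z s1
  = x s2 + y^n s3. The cofactor of t may be any element of the image, so one round of reduction is
  enough.\<close>

inductive_set reduced :: "int \<times> int \<Rightarrow> 'k::comm_ring_1 laurent_mpol set" for D where
  monomial: "D = normal_deg j l i \<beta> \<Longrightarrow> (\<beta> = BZ \<Longrightarrow> i = 0) \<Longrightarrow>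
    rees_map (mconst c * normal_monomial j l i \<beta>) \<in> reduced D"
| t_multiple: "g \<in> rees_part (D - (0, 1)) \<Longrightarrow> Poly_Mapping.single 1 1 * g \<in> reduced D"
| add: "f \<in> reduced D \<Longrightarrow> g \<in> reduced D \<Longrightarrow> f + g \<in> reduced D"

lemma rees_part_power: "f \<in> rees_part D \<Longrightarrow> f ^ k \<in> rees_part (int k * fst D, int k * snd D)"
proof (induction k)
  case 0
  show ?case using rees_part_const[of 1]
    by (simp add: ring_homomorphism.hom_one[OF mconst_homomorphism] zero_prod_def)
next
  case (Suc k)
  have "(int (Suc k) * fst D, int (Suc k) * snd D) = D + (int k * fst D, int k * snd D)"
    by (simp add: prod_eq_iff algebra_simps)
  then show ?case using rees_part_mult[OF Suc.prems Suc.IH[OF Suc.prems]] by simp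
qed

text \<open>Short names for the images of the generators; \<open>pre\<close> is the part c y^j s4^l
  s1^i of a normal monomial in front of its basis factor.\<close>

context
  fixes x y z s1 s2 s3 s4 t :: "'k::comm_ring_1 laurent_mpol"
    and pre :: "'k \<Rightarrow> nat \<Rightarrow> nat \<Rightarrow> nat \<Rightarrow> 'k laurent_mpol" and elem :: "basis \<Rightarrow> 'k laurent_mpol"
  defines "x \<equiv> gen_image Gx" and "y \<equiv> gen_image Gy" and "z \<equiv> gen_image Gz"
    and "s1 \<equiv> gen_image Gs1" and "s2 \<equiv> gen_image Gs2" and "s3 \<equiv> gen_image Gs3" and "s4 \<equiv> gen_image Gs4"
    and "t \<equiv> gen_image Gt"
    and "pre \<equiv> \<lambda>c j l i. Poly_Mapping.single 0 (mconst c) * y ^ j * s4 ^ l * s1 ^ i"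
    and "elem \<equiv> \<lambda>\<beta>. rees_map (basis_elem \<beta>)"
begin

text \<open>The relations oriented as rewriting rules: each left side is a product that no normal
  monomial contains.\<close>

lemma gen_image_relations:
  "x * x = y ^ n * z + t * s1" "x * z = y ^ (2 * n + q) + t * s2" "z * z = x * y ^ (n + q) - t * s3"
  "z * s3 = x * y ^ q * s1 - y ^ (n + q) * s2 - t * s4"
  "s2 * s3 = y ^ q * s1 ^ 2 - x * s4" "z * s2 = y ^ (n + q) * s1 - x * s3"
  "z * s1 = x * s2 + y ^ n * s3" "s3 * s3 = z * s4 - y ^ q * s1 * s2" "s2 * s2 = y ^ n * s4 - s1 * s3"
proof -
  have s: "Poly_Mapping.single i (a::(coord, 'k) mpol) + Poly_Mapping.single i b = Poly_Mapping.single i (a + b)"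
    "Poly_Mapping.single i (a::(coord, 'k) mpol) - Poly_Mapping.single i b = Poly_Mapping.single i (a - b)"
    for i :: int and a b by (simp_all add: single_add single_diff)
  note defs = x_def y_def z_def s1_def s2_def s3_def s4_def t_def gen_image.simps mult_single single_power s
  show "x * x = y ^ n * z + t * s1" "x * z = y ^ (2 * n + q) + t * s2" "z * z = x * y ^ (n + q) - t * s3"
    by (simp_all add: defs F1_def F2_def F3_def power2_eq_square)
  show "z * s3 = x * y ^ q * s1 - y ^ (n + q) * s2 - t * s4"
    by (simp add: defs F4_def)
  show "s2 * s3 = y ^ q * s1 ^ 2 - x * s4" "z * s2 = y ^ (n + q) * s1 - x * s3"
    "z * s1 = x * s2 + y ^ n * s3" "s3 * s3 = z * s4 - y ^ q * s1 * s2" "s2 * s2 = y ^ n * s4 - s1 * s3"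
    by (simp_all add: defs F_syzygies[symmetric] power2_eq_square)
qed

lemma elem_simps:
  "elem B1 = 1" "elem B2 = s2" "elem B3 = s3" "elem BX1 = x" "elem BX2 = x * s2" "elem BX3 = x * s3" "elem BZ = z"
  by (simp_all add: elem_def rees_map_simps x_def z_def s2_def s3_def)

lemma rees_map_normal_monomial: "rees_map (mconst c * normal_monomial j l i \<beta>) = pre c j l i * elem \<beta>"
  by (simp add: normal_monomial_def pre_def elem_def rees_map_simps y_def s4_def s1_def mult.assoc del: gen_image.simps)

lemma normal_mem:
  "D = normal_deg j l i \<beta> \<Longrightarrow> (\<beta> = BZ \<Longrightarrow> i = 0) \<Longrightarrow> pre c j l i * elem \<beta> \<in> reduced D"
  using reduced.monomial[of D j l i \<beta> c] by (simp add: rees_map_normal_monomial)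

lemma elem_rees_part: "elem \<beta> \<in> rees_part (basis_deg \<beta>)"
proof -
  note g = rees_part_gen[where 'a = 'k]
  have "(1 :: 'k laurent_mpol) \<in> rees_part 0"
    using rees_part_const[of "1 :: 'k"] by (simp add: ring_homomorphism.hom_one[OF mconst_homomorphism])
  then show ?thesis
    using g[of Gx] g[of Gz] g[of Gs2] g[of Gs3] rees_part_mult[OF g[of Gx] g[of Gs2]] rees_part_mult[OF g[of Gx] g[of Gs3]]
    by (cases \<beta>) (simp_all add: elem_simps degree_of_gen_eqs zero_prod_def x_def z_def s2_def s3_def del: gen_image.simps)
qed

lemma normal_rees_part: "pre c j l i * elem \<beta> \<in> rees_part (normal_deg j l i \<beta>)"
proof -
  note g = rees_part_gen[where 'a = 'k]
  show ?thesis
    using rees_part_mult[OF rees_part_mult[OF rees_part_mult[OF rees_part_mult[OF rees_part_const[of c]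
        rees_part_power[OF g[of Gy], of j]] rees_part_power[OF g[of Gs4], of l]] rees_part_power[OF g[of Gs1], of i]]
        elem_rees_part[of \<beta>]]
    by (simp add: pre_def y_def s4_def s1_def degree_of_gen_eqs normal_deg_def zero_prod_def ac_simps distrib_left distrib_right del: gen_image.simps)
qed

lemma t_multiple_mem: "g \<in> rees_part D' \<Longrightarrow> D = D' + (0, 1) \<Longrightarrow> t * g \<in> reduced D"
  using reduced.t_multiple[of g D] by (simp add: t_def)

lemma t_gen_normal_mem:
  "D = degree_of_gen v + normal_deg j l i \<beta> + (0, 1) \<Longrightarrow> t * (gen_image v * (pre c j l i * elem \<beta>)) \<in> reduced D"
  by (rule t_multiple_mem[OF rees_part_mult[OF rees_part_gen normal_rees_part]])

text \<open>Multiples of t stay multiples of t under any generator, so only normal monomials have to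
  be tested.\<close>

lemma mult_closedI:
  assumes "\<And>(c :: 'k) (j :: nat) (l :: nat) (i :: nat) \<beta>. (\<beta> = BZ \<Longrightarrow> i = 0) \<Longrightarrow>
      gen_image v * (pre c j l i * elem \<beta>) \<in> reduced (normal_deg j l i \<beta> + degree_of_gen v)"
    and "(f :: 'k laurent_mpol) \<in> reduced D"
  shows "gen_image v * f \<in> reduced (D + degree_of_gen v)"
  using assms(2)
proof (induction rule: reduced.induct)
  case (monomial j l i \<beta> c)
  then show ?case using assms(1)[of \<beta> i c j l] by (simp add: rees_map_normal_monomial del: gen_image.simps)
next
  case (t_multiple g)
  have "t * (gen_image v * g) \<in> reduced (D + degree_of_gen v)"
    by (rule t_multiple_mem[OF rees_part_mult[OF rees_part_gen t_multiple]]) (simp add: prod_eq_iff)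
  then show ?case by (simp add: t_def mult.left_commute del: gen_image.simps) (simp add: mult.left_commute)
next
  case (add f g)
  then show ?case by (simp add: distrib_left reduced.add del: gen_image.simps)
qed

lemmas deg_simps = normal_deg_def degree_of_gen_eqs

lemma mconst_uminus: "mconst (- c) = - (mconst c :: ('v, 'k) mpol)"
  by (rule ring_homomorphism.hom_uminus[OF mconst_homomorphism])

lemmas norm_simps = pre_def elem_simps mconst_uminus single_uminus power_add algebra_simps

section \<open>Closure of the normal forms under the generators\<close>

lemma y_closed: "f \<in> reduced D \<Longrightarrow> y * f \<in> reduced (D + degree_of_gen Gy)"
  unfolding y_def
proof (rule mult_closedI, fold y_def)
  fix c :: 'k and j l i :: nat and \<beta> assume \<beta>: "\<beta> = BZ \<Longrightarrow> i = 0"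
  have "pre c (Suc j) l i * elem \<beta> \<in> reduced (normal_deg j l i \<beta> + degree_of_gen Gy)"
    by (rule normal_mem) (use \<beta> in \<open>simp_all add: deg_simps\<close>)
  then show "y * (pre c j l i * elem \<beta>) \<in> reduced (normal_deg j l i \<beta> + degree_of_gen Gy)"
    by (simp add: pre_def ac_simps)
qed

lemma y_power_closed: "f \<in> reduced D \<Longrightarrow> y ^ k * f \<in> reduced (D + (3 * int k, 0))"
proof (induction k)
  case 0
  then show ?case by (simp add: zero_prod_def[symmetric])
next
  case (Suc k)
  have "D + (3 * int (Suc k), 0) = D + (3 * int k, 0) + degree_of_gen Gy"
    by (simp add: prod_eq_iff degree_of_gen_eqs)
  then show ?case using y_closed[OF Suc.IH[OF Suc.prems]] by (simp only: power_Suc mult.assoc)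
qed

lemma s4_closed: "f \<in> reduced D \<Longrightarrow> s4 * f \<in> reduced (D + degree_of_gen Gs4)"
  unfolding s4_def
proof (rule mult_closedI, fold s4_def)
  fix c :: 'k and j l i :: nat and \<beta> assume \<beta>: "\<beta> = BZ \<Longrightarrow> i = 0"
  have "pre c j (Suc l) i * elem \<beta> \<in> reduced (normal_deg j l i \<beta> + degree_of_gen Gs4)"
    by (rule normal_mem) (use \<beta> in \<open>simp_all add: deg_simps algebra_simps\<close>)
  then show "s4 * (pre c j l i * elem \<beta>) \<in> reduced (normal_deg j l i \<beta> + degree_of_gen Gs4)"
    by (simp add: pre_def ac_simps)
qed

text \<open>In every case one rule produces normal monomials and multiples of t at once. The closure
  lemmas for x, s1, s2 and s3 fall back on this one, which is why it precedes them.\<close>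

lemma z_closed: "f \<in> reduced D \<Longrightarrow> z * f \<in> reduced (D + degree_of_gen Gz)"
  unfolding z_def
proof (rule mult_closedI, fold z_def)
  fix c :: 'k and j l i :: nat and \<beta> assume \<beta>: "\<beta> = BZ \<Longrightarrow> i = 0"
  let ?D = "normal_deg j l i \<beta> + degree_of_gen Gz"
  show "z * (pre c j l i * elem \<beta>) \<in> reduced ?D"
  proof (cases \<beta>)
    case B1
    show ?thesis
    \<comment> \<open>Without s1 the product is the normal monomial with \<open>BZ\<close>;
      otherwise one factor s1 is consumed by z s1 = x s2 + y^n s3.\<close>
    proof (cases i)
      case 0
      have "pre c j l 0 * elem BZ \<in> reduced ?D"
        by (rule normal_mem) (simp_all add: B1 0 deg_simps)
      then show ?thesis by (simp add: B1 0 elem_simps mult.commute)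
    next
      case (Suc k)
      have "pre c j l k * elem BX2 + pre c (j + n) l k * elem B3 \<in> reduced ?D" (is "?E \<in> _")
        by (intro reduced.add normal_mem) (simp_all add: B1 Suc deg_simps algebra_simps)
      also have "?E = pre c j l k * (z * s1)"
        unfolding gen_image_relations by (simp add: norm_simps)
      finally show ?thesis by (simp add: B1 Suc pre_def elem_simps ac_simps)
    qed
  next
    case B2
    have "pre c (j + (n + q)) l (Suc i) * elem B1 + pre (- c) j l i * elem BX3 \<in> reduced ?D" (is "?E \<in> _")
      by (intro reduced.add normal_mem) (simp_all add: B2 deg_simps algebra_simps)
    also have "?E = pre c j l i * (z * s2)"
      unfolding gen_image_relations by (simp add: norm_simps)
    finally show ?thesis by (simp only: B2 elem_simps mult.left_commute)
  next
    case B3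
    have "pre c (j + q) l (Suc i) * elem BX1 + pre (- c) (j + (n + q)) l i * elem B2
        + t * (s4 * (pre (- c) j l i * elem B1)) \<in> reduced ?D" (is "?E \<in> _")
      unfolding s4_def
      by (intro reduced.add normal_mem t_gen_normal_mem) (simp_all add: B3 deg_simps algebra_simps)
    also have "?E = pre c j l i * (z * s3)"
      unfolding gen_image_relations by (simp add: norm_simps)
    finally show ?thesis by (simp only: B3 elem_simps mult.left_commute)
  next
    case BX1
    have "pre c (j + (2 * n + q)) l i * elem B1 + t * (s2 * (pre c j l i * elem B1)) \<in> reduced ?D" (is "?E \<in> _")
      unfolding s2_def
      by (intro reduced.add normal_mem t_gen_normal_mem) (simp_all add: BX1 deg_simps algebra_simps)
    also have "?E = pre c j l i * (x * z)"
      unfolding gen_image_relations by (simp add: norm_simps)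
    finally show ?thesis by (simp add: BX1 elem_simps ac_simps)
  next
    case BX2
    have "pre c (j + (2 * n + q)) l i * elem B2 + t * (s2 * (pre c j l i * elem B2)) \<in> reduced ?D" (is "?E \<in> _")
      unfolding s2_def
      by (intro reduced.add normal_mem t_gen_normal_mem) (simp_all add: BX2 deg_simps algebra_simps)
    also have "?E = pre c j l i * (x * z) * s2"
      unfolding gen_image_relations by (simp add: norm_simps)
    finally show ?thesis by (simp add: BX2 elem_simps ac_simps)
  next
    case BX3
    have "pre c (j + (2 * n + q)) l i * elem B3 + t * (s2 * (pre c j l i * elem B3)) \<in> reduced ?D" (is "?E \<in> _")
      unfolding s2_def
      by (intro reduced.add normal_mem t_gen_normal_mem) (simp_all add: BX3 deg_simps algebra_simps)
    also have "?E = pre c j l i * (x * z) * s3"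
      unfolding gen_image_relations by (simp add: norm_simps)
    finally show ?thesis by (simp add: BX3 elem_simps ac_simps)
  next
    case BZ
    have "pre c (j + (n + q)) l i * elem BX1 + t * (s3 * (pre (- c) j l i * elem B1)) \<in> reduced ?D" (is "?E \<in> _")
      unfolding s3_def
      by (intro reduced.add normal_mem t_gen_normal_mem) (simp_all add: BZ deg_simps algebra_simps)
    also have "?E = pre c j l i * (z * z)"
      unfolding gen_image_relations by (simp add: norm_simps)
    finally show ?thesis by (simp only: BZ elem_simps mult.left_commute)
  qed
qed

lemma x_closed: "f \<in> reduced D \<Longrightarrow> x * f \<in> reduced (D + degree_of_gen Gx)"
  unfolding x_def
proof (rule mult_closedI, fold x_def)
  fix c :: 'k and j l i :: nat and \<beta> assume \<beta>: "\<beta> = BZ \<Longrightarrow> i = 0"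
  let ?D = "normal_deg j l i \<beta> + degree_of_gen Gx"
  \<comment> \<open>By x^2 = y^n z + t s1. The term with z need not be normal and is passed to
    \<open>z_closed\<close>.\<close>
  have reduce_xx: "x * (pre c j l i * (x * elem \<beta>')) \<in> reduced ?D"
    if "normal_deg j l i \<beta> = normal_deg j l i \<beta>' + degree_of_gen Gx" "\<beta>' \<noteq> BZ" for \<beta>'
  proof -
    have "y ^ n * (z * (pre c j l i * elem \<beta>')) \<in> reduced (normal_deg j l i \<beta>' + degree_of_gen Gz + (3 * int n, 0))"
      by (intro y_power_closed z_closed normal_mem refl) (use that in simp)
    also have "normal_deg j l i \<beta>' + degree_of_gen Gz + (3 * int n, 0) = ?D"
      unfolding that(1) by (simp add: deg_simps)
    finally have "y ^ n * (z * (pre c j l i * elem \<beta>')) + t * (s1 * (pre c j l i * elem \<beta>')) \<in> reduced ?D" (is "?E \<in> _")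
      unfolding s1_def
      by (intro reduced.add t_gen_normal_mem) (simp, simp only: that(1), simp add: deg_simps)
    also have "?E = (x * x) * (pre c j l i * elem \<beta>')"
      unfolding gen_image_relations by (simp add: algebra_simps)
    finally show ?thesis by (simp add: ac_simps)
  qed
  show "x * (pre c j l i * elem \<beta>) \<in> reduced ?D"
  proof (cases \<beta>)
    case B1
    have "pre c j l i * elem BX1 \<in> reduced ?D"
      by (rule normal_mem) (simp_all add: B1 deg_simps)
    then show ?thesis by (simp add: B1 elem_simps mult.commute)
  next
    case B2
    have "pre c j l i * elem BX2 \<in> reduced ?D"
      by (rule normal_mem) (simp_all add: B2 deg_simps)
    then show ?thesis by (simp add: B2 elem_simps mult.left_commute)
  next
    case B3
    have "pre c j l i * elem BX3 \<in> reduced ?D"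
      by (rule normal_mem) (simp_all add: B3 deg_simps)
    then show ?thesis by (simp add: B3 elem_simps mult.left_commute)
  next
    case BX1
    then show ?thesis using reduce_xx[of B1] by (simp add: elem_simps deg_simps)
  next
    case BX2
    then show ?thesis using reduce_xx[of B2] by (simp add: elem_simps deg_simps)
  next
    case BX3
    then show ?thesis using reduce_xx[of B3] by (simp add: elem_simps deg_simps)
  next
    case BZ
    have "pre c (j + (2 * n + q)) l i * elem B1 + t * (s2 * (pre c j l i * elem B1)) \<in> reduced ?D" (is "?E \<in> _")
      unfolding s2_def
      by (intro reduced.add normal_mem t_gen_normal_mem) (simp_all add: BZ deg_simps algebra_simps)
    also have "?E = pre c j l i * (x * z)"
      unfolding gen_image_relations by (simp add: norm_simps)
    finally show ?thesis by (simp add: BZ elem_simps ac_simps)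
  qed
qed

lemma reduced_subset_rees_part: "(f :: 'k laurent_mpol) \<in> reduced D \<Longrightarrow> f \<in> rees_part D"
proof (induction rule: reduced.induct)
  case (monomial j l i \<beta> c)
  then show ?case using normal_rees_part by (simp add: rees_map_normal_monomial)
next
  case (t_multiple g)
  then show ?case using rees_part_mult[OF rees_part_gen[of Gt] t_multiple] by (simp add: prod_eq_iff)
qed (rule rees_part_add)

lemma t_closed: "f \<in> reduced D \<Longrightarrow> t * f \<in> reduced (D + degree_of_gen Gt)"
  by (rule t_multiple_mem[OF reduced_subset_rees_part]) simp_all

lemma s1_closed: "f \<in> reduced D \<Longrightarrow> s1 * f \<in> reduced (D + degree_of_gen Gs1)"
  unfolding s1_def
proof (rule mult_closedI, fold s1_def)
  fix c :: 'k and j l i :: nat and \<beta> assume \<beta>: "\<beta> = BZ \<Longrightarrow> i = 0"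
  let ?D = "normal_deg j l i \<beta> + degree_of_gen Gs1"
  show "s1 * (pre c j l i * elem \<beta>) \<in> reduced ?D"
  proof (cases "\<beta> = BZ")
    case True
    \<comment> \<open>As z s1 is not normal, the product is read as z times a normal power of
      s1.\<close>
    have "z * (pre c j l (Suc i) * elem B1) \<in> reduced (normal_deg j l (Suc i) B1 + degree_of_gen Gz)"
      by (intro z_closed normal_mem) simp_all
    also have "normal_deg j l (Suc i) B1 + degree_of_gen Gz = ?D"
      by (simp add: True deg_simps algebra_simps)
    finally show ?thesis by (simp add: True pre_def elem_simps ac_simps)
  next
    case False
    have "pre c j l (Suc i) * elem \<beta> \<in> reduced ?D"
      by (rule normal_mem) (use False in \<open>simp_all add: deg_simps algebra_simps\<close>)
    then show ?thesis by (simp add: pre_def ac_simps)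
  qed
qed

text \<open>The products of s2 and s3 with 1, s2, s3 are reduced by rules; a further factor x or z
  is pulled out and handled by \<open>x_closed\<close> or \<open>z_closed\<close>. The two
  generators are treated together because they share the product s2 s3.\<close>

lemma s23_closed:
  assumes v: "v \<in> {Gs2, Gs3}" and f: "(f :: 'k laurent_mpol) \<in> reduced D"
  shows "gen_image v * f \<in> reduced (D + degree_of_gen v)"
proof (rule mult_closedI[OF _ f])
  fix c :: 'k and j l i :: nat and \<beta> assume \<beta>: "\<beta> = BZ \<Longrightarrow> i = 0"
  have s22: "s2 * (pre c j l i * s2) \<in> reduced (normal_deg j l i B2 + degree_of_gen Gs2)" for i
  proof -
    have "pre c (j + n) (Suc l) i * elem B1 + pre (- c) j l (Suc i) * elem B3
        \<in> reduced (normal_deg j l i B2 + degree_of_gen Gs2)" (is "?E \<in> _")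
      by (intro reduced.add normal_mem) (simp_all add: deg_simps algebra_simps)
    also have "?E = pre c j l i * (s2 * s2)"
      unfolding gen_image_relations by (simp add: norm_simps)
    finally show ?thesis by (simp only: mult.left_commute)
  qed
  have s23: "s2 * (pre c j l i * s3) \<in> reduced (normal_deg j l i B3 + degree_of_gen Gs2)" for i
  proof -
    have "pre c (j + q) l (Suc (Suc i)) * elem B1 + pre (- c) j (Suc l) i * elem BX1
        \<in> reduced (normal_deg j l i B3 + degree_of_gen Gs2)" (is "?E \<in> _")
      by (intro reduced.add normal_mem) (simp_all add: deg_simps algebra_simps)
    also have "?E = pre c j l i * (s2 * s3)"
      unfolding gen_image_relations by (simp add: norm_simps power2_eq_square)
    finally show ?thesis by (simp only: mult.left_commute)
  qed
  have s33: "s3 * (pre c j l i * s3) \<in> reduced (normal_deg j l i B3 + degree_of_gen Gs3)" for i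
  proof -
    \<comment> \<open>The term z s4 of s3^2 meets the power s1^i, so it goes through
      \<open>z_closed\<close>.\<close>
    have "z * (pre c j (Suc l) i * elem B1) \<in> reduced (normal_deg j (Suc l) i B1 + degree_of_gen Gz)"
      by (intro z_closed normal_mem) simp_all
    also have "normal_deg j (Suc l) i B1 + degree_of_gen Gz = normal_deg j l i B3 + degree_of_gen Gs3"
      by (simp add: deg_simps algebra_simps)
    finally have "z * (pre c j (Suc l) i * elem B1) + pre (- c) (j + q) l (Suc i) * elem B2
        \<in> reduced (normal_deg j l i B3 + degree_of_gen Gs3)" (is "?E \<in> _")
      by (intro reduced.add normal_mem) (simp_all add: deg_simps algebra_simps)
    also have "?E = pre c j l i * (s3 * s3)"
      unfolding gen_image_relations by (simp add: norm_simps)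
    finally show ?thesis by (simp only: mult.left_commute)
  qed
  have base: "gen_image v * (pre c j l i * elem \<beta>) \<in> reduced (normal_deg j l i \<beta> + degree_of_gen v)"
    if "\<beta> \<in> {B1, B2, B3}" for i \<beta>
  proof -
    have "pre c j l i * elem B2 \<in> reduced (normal_deg j l i B1 + degree_of_gen Gs2)"
      "pre c j l i * elem B3 \<in> reduced (normal_deg j l i B1 + degree_of_gen Gs3)"
      by (rule normal_mem; simp add: deg_simps)+
    moreover have "normal_deg j l i B2 + degree_of_gen Gs3 = normal_deg j l i B3 + degree_of_gen Gs2"
      by (simp add: deg_simps)
    ultimately show ?thesis
      using that v s22[of i] s23[of i] s33[of i]
      by (auto simp: elem_simps ac_simps s2_def[symmetric] s3_def[symmetric] simp del: gen_image.simps)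
  qed
  have x: "gen_image v * (pre c j l i * (x * elem \<beta>')) \<in> reduced (normal_deg j l i \<beta>' + degree_of_gen v + degree_of_gen Gx)"
    if "\<beta>' \<in> {B1, B2, B3}" for \<beta>'
    using x_closed[OF base[OF that, of i]] by (simp only: ac_simps)
  have z: "gen_image v * (pre c j l i * z) \<in> reduced (normal_deg j l i B1 + degree_of_gen v + degree_of_gen Gz)"
    using z_closed[OF base[of B1 i]] by (simp only: ac_simps elem_simps) simp
  show "gen_image v * (pre c j l i * elem \<beta>) \<in> reduced (normal_deg j l i \<beta> + degree_of_gen v)"
  proof (cases "\<beta> \<in> {B1, B2, B3}")
    case True
    then show ?thesis by (rule base)
  next
    case False
    have "normal_deg j l i BX1 = normal_deg j l i B1 + degree_of_gen Gx"
      "normal_deg j l i BX2 = normal_deg j l i B2 + degree_of_gen Gx"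
      "normal_deg j l i BX3 = normal_deg j l i B3 + degree_of_gen Gx"
      "normal_deg j l i BZ = normal_deg j l i B1 + degree_of_gen Gz"
      by (simp_all add: deg_simps)
    then show ?thesis
      using False x[of B1] x[of B2] x[of B3] z
      by (cases \<beta>) (simp_all only: elem_simps insert_iff, simp_all add: ac_simps del: gen_image.simps)
  qed
qed

end

lemma gen_closed:
  assumes "f \<in> (reduced D :: 'k::comm_ring_1 laurent_mpol set)"
  shows "gen_image v * f \<in> reduced (D + degree_of_gen v)"
  by (cases v) (use assms in \<open>simp_all only: x_closed y_closed z_closed s1_closed s23_closed s4_closed t_closed
    insert_iff simp_thms\<close>)

end

context monomial_curve
begin

lemma const_reduced: "Poly_Mapping.single 0 (mconst c) \<in> (reduced 0 :: 'k::comm_ring_1 laurent_mpol set)"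
  using reduced.monomial[of 0 0 0 0 B1 c]
  by (simp add: normal_monomial_def normal_deg_def zero_prod_def)

lemma rees_map_eq_sum:
  "rees_map (f :: (gen, 'k::comm_ring_1) mpol) =
    (\<Sum>e\<in>Poly_Mapping.keys f. Poly_Mapping.single 0 (mconst (Poly_Mapping.lookup f e)) * eval_monomial gen_image e)"
  by (simp add: rees_map_def mpol_subst_def linear_extension_def)

text \<open>Constants are normal forms and every generator preserves normal forms, so every
  monomial, applied to a constant, yields one.\<close>

lemma rees_part_subset_reduced:
  assumes "f \<in> rees_part D" shows "f \<in> (reduced D :: 'k::comm_ring_1 laurent_mpol set)"
proof -
  obtain F where F: "F \<in> bihomogeneous_part degree_of_gen D" and f: "f = rees_map F"
    using assms by (auto simp: rees_part_def)
  \<comment> \<open>Multipliers that raise the degree by D and preserve normal forms.\<close>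
  let ?C = "\<lambda>D. {g :: 'k laurent_mpol. \<forall>D'. \<forall>f\<in>reduced D'. g * f \<in> reduced (D' + D)}"
  have m: "eval_monomial gen_image e \<in> ?C (monomial_deg (fst \<circ> degree_of_gen) e, monomial_deg (snd \<circ> degree_of_gen) e)" for e
  proof (rule monomial_memI)
    fix D1 D2 and g g' :: "'k laurent_mpol" assume g: "g \<in> ?C D1" "g' \<in> ?C D2"
    have "g * g' * f \<in> reduced (D' + (D1 + D2))" if "f \<in> reduced D'" for f D'
    proof -
      have "g' * f \<in> reduced (D' + D2)" using g(2) that by blast
      then have "g * (g' * f) \<in> reduced (D' + D2 + D1)" using g(1) by blast
      then show ?thesis by (simp only: ac_simps)
    qed
    then show "g * g' \<in> ?C (D1 + D2)" by blast
  qed (simp_all add: gen_closed del: gen_image.simps)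
  have t: "Poly_Mapping.single 0 (mconst (Poly_Mapping.lookup F e)) * eval_monomial gen_image e \<in> reduced D"
    if "e \<in> Poly_Mapping.keys F" for e
  proof -
    have "(monomial_deg (fst \<circ> degree_of_gen) e, monomial_deg (snd \<circ> degree_of_gen) e) = D"
      using F that by (simp add: bihomogeneous_part_def homogeneous_part_def prod_eq_iff)
    then have "eval_monomial gen_image e * Poly_Mapping.single 0 (mconst (Poly_Mapping.lookup F e)) \<in> reduced (0 + D)"
      using m[of e] const_reduced by blast
    then show ?thesis by (simp add: mult.commute)
  qed
  have zero: "0 \<in> (reduced D :: 'k laurent_mpol set)"
    using reduced.t_multiple[OF rees_part_zero, of D] by simp
  have "(\<Sum>e\<in>A. Poly_Mapping.single 0 (mconst (Poly_Mapping.lookup F e)) * eval_monomial gen_image e) \<in> reduced D"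
    if "finite A" "A \<subseteq> Poly_Mapping.keys F" for A
    using that by (induction A) (auto simp: zero intro!: reduced.add t)
  then show ?thesis by (simp add: f rees_map_eq_sum)
qed

section \<open>Normal monomials are independent modulo \<open>t\<close>\<close>

fun basis_spec :: "basis \<Rightarrow> 'k::field_char_0 poly" where
  "basis_spec B1 = 1" | "basis_spec B2 = [:0, 1:]" | "basis_spec B3 = [:1, -1:]"
| "basis_spec BX1 = 1" | "basis_spec BX2 = [:0, 1:]" | "basis_spec BX3 = [:1, -1:]" | "basis_spec BZ = 1"

lemma spec0_normal_monomial:
  "spec0 (mconst c * normal_monomial j l i \<beta>) = smult c ([:1, -1, 1:] ^ l * basis_spec \<beta> :: 'k::field_char_0 poly)"
proof -
  have "spec0 (basis_elem \<beta>) = (basis_spec \<beta> :: 'k poly)"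
    by (cases \<beta>) (simp_all add: spec0_simps spec0_mvar)
  then show ?thesis
    by (simp add: normal_monomial_def spec0_simps spec0_mvar spec0_mconst)
qed

definition valid :: "int \<times> int \<Rightarrow> nat \<Rightarrow> nat \<Rightarrow> nat \<Rightarrow> basis \<Rightarrow> bool"
  where "valid D l j i \<beta> \<longleftrightarrow> D = normal_deg j l i \<beta> \<and> (\<beta> = BZ \<longrightarrow> i = 0)"

text \<open>For fixed D and l, the second degree determines i from the label. The first degree then
  fixes, modulo 3, the multiple of q that the label contributes; the residue is this
  multiple.\<close>

fun residue :: "basis \<Rightarrow> int" where
  "residue B1 = 0" | "residue B2 = 1" | "residue B3 = 2"
| "residue BX1 = 1" | "residue BX2 = 2" | "residue BX3 = 0" | "residue BZ = 2"

lemma valid_residue: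
  assumes "valid D l j i \<beta>"
  shows "3 dvd (fst D - 2 * int q * (- snd D - 2 * int l) - residue \<beta> * int q)"
proof -
  \<comment> \<open>The label's contribution to the quotient by 3.\<close>
  define \<eta> where "\<eta> = (case \<beta> of B1 \<Rightarrow> 0 | B2 \<Rightarrow> 2 * int n | B3 \<Rightarrow> 2 * int n | BX1 \<Rightarrow> int n
    | BX2 \<Rightarrow> 3 * int n | BX3 \<Rightarrow> 3 * int n + int q | BZ \<Rightarrow> int n)"
  have "fst D - 2 * int q * (- snd D - 2 * int l) - residue \<beta> * int q
      = 3 * (int j + (3 * int n + 2 * int q) * int l + 2 * int n * int i + \<eta>)"
    using assms by (cases \<beta>) (simp_all add: valid_def normal_deg_def \<eta>_def algebra_simps)
  then show ?thesis by simp
qed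

text \<open>As q is invertible modulo 3, the residues agree. The classes are {\<open>B1\<close>,
  \<open>BX3\<close>}, {\<open>B2\<close>, \<open>BX1\<close>} and {\<open>B3\<close>,
  \<open>BX2\<close>, \<open>BZ\<close>}; in the last, \<open>BZ\<close> forces second degree -2l,
  while \<open>B3\<close> and \<open>BX2\<close> have at most -2l - 1. So at most two labels
  coexist.\<close>

lemma valid_same_residue:
  assumes "valid D l j i \<beta>" "valid D l j' i' \<beta>'"
  shows "residue \<beta> = residue \<beta>'" and "\<beta> = BZ \<Longrightarrow> \<beta>' \<noteq> B3 \<and> \<beta>' \<noteq> BX2"
proof -
  have "3 dvd (residue \<beta> - residue \<beta>') * int q"
    using dvd_diff[OF valid_residue[OF assms(2)] valid_residue[OF assms(1)]]
    by (simp add: algebra_simps)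
  moreover have "\<not> 3 dvd int q" using q_not_3 by presburger
  moreover have "residue \<beta> - residue \<beta>' \<in> {-2, -1, 0, 1, 2}"
    by (cases \<beta>; cases \<beta>') simp_all
  ultimately show "residue \<beta> = residue \<beta>'" by auto presburger+
  show "\<beta>' \<noteq> B3 \<and> \<beta>' \<noteq> BX2" if "\<beta> = BZ"
    using assms that by (auto simp: valid_def normal_deg_def)
qed

text \<open>The part of degree \<open>D\<close> with a fixed exponent \<open>l\<close> of \<open>s\<^sub>4\<close>. The exponents \<open>j\<close> and \<open>i\<close> are determined by \<open>D\<close>, \<open>l\<close>
  and \<open>\<beta>\<close>.\<close>

definition layer :: "int \<times> int \<Rightarrow> nat \<Rightarrow> (gen, 'k::field_char_0) mpol set"
  where "layer D l = {w. \<exists>c j i. (\<forall>\<beta>. c \<beta> \<noteq> 0 \<longrightarrow> valid D l (j \<beta>) (i \<beta>) \<beta>) \<and>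
     w = (\<Sum>\<beta>\<in>UNIV. mconst (c \<beta>) * normal_monomial (j \<beta>) l (i \<beta>) \<beta>)}"

lemma layer_zero: "0 \<in> layer D l"
  unfolding layer_def
  by (auto intro!: exI[of _ "\<lambda>_. 0"] simp: ring_homomorphism.hom_zero[OF mconst_homomorphism])

lemma valid_unique: "valid D l j i \<beta> \<Longrightarrow> valid D l j' i' \<beta> \<Longrightarrow> j = j' \<and> i = i'"
  by (auto simp: valid_def normal_deg_def)

lemma layer_add:
  assumes "w \<in> layer D l" "w' \<in> layer D l"
  shows "w + w' \<in> (layer D l :: (gen, 'k::field_char_0) mpol set)"
proof -
  obtain c j i where w: "\<forall>\<beta>. c \<beta> \<noteq> 0 \<longrightarrow> valid D l (j \<beta>) (i \<beta>) \<beta>"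
     "w = (\<Sum>\<beta>\<in>UNIV. mconst (c \<beta>) * normal_monomial (j \<beta>) l (i \<beta>) \<beta>)"
    using assms(1) unfolding layer_def by blast
  obtain c' j' i' where w': "\<forall>\<beta>. c' \<beta> \<noteq> 0 \<longrightarrow> valid D l (j' \<beta>) (i' \<beta>) \<beta>"
     "w' = (\<Sum>\<beta>\<in>UNIV. mconst (c' \<beta>) * normal_monomial (j' \<beta>) l (i' \<beta>) \<beta>)"
    using assms(2) unfolding layer_def by blast
  \<comment> \<open>Exponents at a zero coefficient are arbitrary, so there the other summand's
    exponents are taken; where both coefficients are nonzero the exponents agree.\<close>
  let ?j = "\<lambda>\<beta>. if c \<beta> = 0 then j' \<beta> else j \<beta>" and ?i = "\<lambda>\<beta>. if c \<beta> = 0 then i' \<beta> else i \<beta>"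
  have "mconst (c \<beta>) * normal_monomial (j \<beta>) l (i \<beta>) \<beta> + mconst (c' \<beta>) * normal_monomial (j' \<beta>) l (i' \<beta>) \<beta>
      = mconst (c \<beta> + c' \<beta>) * normal_monomial (?j \<beta>) l (?i \<beta>) \<beta>" for \<beta>
  proof -
    have "j \<beta> = j' \<beta> \<and> i \<beta> = i' \<beta>" if "c \<beta> \<noteq> 0" "c' \<beta> \<noteq> 0"
      using valid_unique w(1) w'(1) that by blast
    then show ?thesis
      by (cases "c \<beta> = 0"; cases "c' \<beta> = 0")
        (auto simp: ring_homomorphism.hom_simps[OF mconst_homomorphism] distrib_right)
  qed
  then have "w + w' = (\<Sum>\<beta>\<in>UNIV. mconst (c \<beta> + c' \<beta>) * normal_monomial (?j \<beta>) l (?i \<beta>) \<beta>)"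
    by (simp add: w(2) w'(2) sum.distrib[symmetric])
  moreover have "\<forall>\<beta>. c \<beta> + c' \<beta> \<noteq> 0 \<longrightarrow> valid D l (?j \<beta>) (?i \<beta>) \<beta>"
    using w(1) w'(1) by auto
  ultimately show ?thesis
    unfolding layer_def by (intro CollectI exI[of _ "\<lambda>\<beta>. c \<beta> + c' \<beta>"] exI[of _ ?j] exI[of _ ?i] conjI)
qed

lemma layer_monomial:
  assumes "valid D l j i \<beta>"
  shows "mconst c * normal_monomial j l i \<beta> \<in> (layer D l :: (gen, 'k::field_char_0) mpol set)"
proof -
  have "mconst c * normal_monomial j l i \<beta> =
      (\<Sum>\<beta>'\<in>UNIV. mconst (if \<beta>' = \<beta> then c else 0) * normal_monomial j l i \<beta>' :: (gen, 'k) mpol)"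
    by (subst sum.mono_neutral_right[of UNIV "{\<beta>}"])
      (auto simp: ring_homomorphism.hom_zero[OF mconst_homomorphism])
  then show ?thesis
    using assms unfolding layer_def
    by (intro CollectI exI[of _ "\<lambda>\<beta>'. if \<beta>' = \<beta> then c else 0"] exI[of _ "\<lambda>_. j"] exI[of _ "\<lambda>_. i"]) auto
qed

text \<open>Besides (1 - v + v^2)^l, only a combination of 1, v and 1 - v remains. The at most two
  labels with nonzero coefficients have independent factors, so the combination vanishes only if the
  layer element does.\<close>

lemma layer_spec0:
  assumes "w \<in> (layer D l :: (gen, 'k::field_char_0) mpol set)"
  shows "\<exists>L. spec0 w = [:1, -1, 1:] ^ l * L \<and> degree L < 2 \<and> (L = 0 \<longrightarrow> w = 0)"
proof -
  obtain c j i where v: "\<And>\<beta>. c \<beta> \<noteq> 0 \<Longrightarrow> valid D l (j \<beta>) (i \<beta>) \<beta>"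
     and w: "w = (\<Sum>\<beta>\<in>UNIV. mconst (c \<beta>) * normal_monomial (j \<beta>) l (i \<beta>) \<beta>)"
    using assms unfolding layer_def by blast
  define L where "L = [:c B1 + c B3 + c BX1 + c BX3 + c BZ, c B2 - c B3 + c BX2 - c BX3:]"
  have "spec0 w = (\<Sum>\<beta>\<in>UNIV. smult (c \<beta>) ([:1, -1, 1:] ^ l * basis_spec \<beta>))"
    by (simp add: w ring_homomorphism.hom_sum[OF spec0_homomorphism] spec0_normal_monomial)
  also have "\<dots> = [:1, -1, 1:] ^ l * (\<Sum>\<beta>\<in>UNIV. smult (c \<beta>) (basis_spec \<beta>))"
    by (simp add: sum_distrib_left)
  also have "(\<Sum>\<beta>\<in>UNIV. smult (c \<beta>) (basis_spec \<beta>)) = L"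
    by (simp add: UNIV_basis L_def one_pCons algebra_simps)
  finally have "spec0 w = [:1, -1, 1:] ^ l * L" .
  moreover have "degree L < 2"
    by (simp add: L_def)
  moreover have "w = 0" if "L = 0"
  proof -
    have eq: "c B1 + c B3 + c BX1 + c BX3 + c BZ = 0" "c B2 - c B3 + c BX2 - c BX3 = 0"
      using that by (simp_all add: L_def)
    \<comment> \<open>A nonzero coefficient forces those of all incompatible labels to vanish; the
      two equations then have at most two unknowns left and only the zero solution.\<close>
    have excl: "c \<beta>' = 0" if "c \<beta> \<noteq> 0" "residue \<beta> \<noteq> residue \<beta>' \<or> \<beta> = BZ \<and> (\<beta>' = B3 \<or> \<beta>' = BX2) \<or> \<beta>' = BZ \<and> (\<beta> = B3 \<or> \<beta> = BX2)"
      for \<beta> \<beta>'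
      using valid_same_residue v that by metis
    have "c \<beta> = 0" for \<beta>
    proof (rule ccontr)
      assume c: "c \<beta> \<noteq> 0"
      show False
        using c eq excl[OF c, of B1] excl[OF c, of B2] excl[OF c, of B3] excl[OF c, of BX1]
          excl[OF c, of BX2] excl[OF c, of BX3] excl[OF c, of BZ]
        by (cases \<beta>) simp_all
    qed
    then show ?thesis by (simp add: w ring_homomorphism.hom_zero[OF mconst_homomorphism])
  qed
  ultimately show ?thesis by blast
qed

text \<open>Normal monomials are collected by their exponent l of s4. The sum is finite because a
  normal monomial has second degree at most -2l.\<close>

lemma reduced_decomposition:
  assumes "f \<in> (reduced D :: 'k::field_char_0 laurent_mpol set)"
  shows "\<exists>G w. G \<in> bihomogeneous_part degree_of_gen (D - (0, 1)) \<and> (\<forall>l. w l \<in> layer D l) \<and>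
     f = rees_map (mvar Gt * G + (\<Sum>l\<le>nat (- snd D). w l))"
  using assms
proof (induction rule: reduced.induct)
  case (monomial j l i \<beta> c)
  let ?w = "\<lambda>l'. if l' = l then mconst c * normal_monomial j l i \<beta> else 0 :: (gen, 'k) mpol"
  have "\<forall>l. ?w l \<in> layer D l"
    using layer_monomial[of D l j i \<beta> c] monomial by (auto simp: layer_zero valid_def)
  moreover have "l \<le> nat (- snd D)"
    using monomial(1) by (cases \<beta>) (simp_all add: normal_deg_def)
  then have "(\<Sum>l\<le>nat (- snd D). ?w l) = mconst c * normal_monomial j l i \<beta>"
    by (simp add: sum.delta)
  ultimately show ?case
    by (intro exI[of _ 0] exI[of _ ?w]) (simp add: bihomogeneous_part_zero)
next
  case (t_multiple g)
  then obtain G where "G \<in> bihomogeneous_part degree_of_gen (D - (0, 1))" "g = rees_map G"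
    by (auto simp: rees_part_def)
  then show ?case
    by (intro exI[of _ G] exI[of _ "\<lambda>_. 0"]) (simp add: layer_zero rees_map_simps)
next
  case (add f g)
  then obtain G w G' w' where "G \<in> bihomogeneous_part degree_of_gen (D - (0, 1))" "\<forall>l. w l \<in> layer D l"
     "f = rees_map (mvar Gt * G + (\<Sum>l\<le>nat (- snd D). w l))"
     "G' \<in> bihomogeneous_part degree_of_gen (D - (0, 1))" "\<forall>l. w' l \<in> layer D l"
     "g = rees_map (mvar Gt * G' + (\<Sum>l\<le>nat (- snd D). w' l))" by blast
  then show ?case
    by (intro exI[of _ "G + G'"] exI[of _ "\<lambda>l. w l + w' l"])
      (simp add: bihomogeneous_part_add layer_add rees_map_simps sum.distrib algebra_simps)
qed

text \<open>The multiple of t disappears at \<tau> = 0, and what is left is an expansion in powers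
  of 1 - v + v^2 with digits of degree below two. Its digits vanish, hence so do all layers, and
  only the multiple of t remains.\<close>

lemma spec0_zero_imp_t_multiple:
  assumes "F \<in> bihomogeneous_part degree_of_gen D" "spec0 F = (0 :: 'k::field_char_0 poly)"
  obtains G where "G \<in> bihomogeneous_part degree_of_gen (D - (0, 1))" "rees_map F = rees_map (mvar Gt * G)"
proof -
  have "rees_map F \<in> reduced D"
    using assms(1) by (intro rees_part_subset_reduced) (simp add: rees_part_def)
  then obtain G w where G: "G \<in> bihomogeneous_part degree_of_gen (D - (0, 1))" and w: "\<And>l. w l \<in> layer D l"
    and F: "rees_map F = rees_map (mvar Gt * G + (\<Sum>l\<le>nat (- snd D). w l))"
    using reduced_decomposition by blast
  from w have "\<forall>l. \<exists>L. spec0 (w l) = [:1, -1, 1:] ^ l * L \<and> degree L < 2 \<and> (L = 0 \<longrightarrow> w l = 0)"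
    using layer_spec0 by blast
  then obtain L where L: "\<And>l. spec0 (w l) = [:1, -1, 1:] ^ l * L l" "\<And>l. degree (L l) < 2" "\<And>l. L l = 0 \<Longrightarrow> w l = 0"
    using choice[of "\<lambda>l L. spec0 (w l) = [:1, -1, 1:] ^ l * L \<and> degree L < 2 \<and> (L = 0 \<longrightarrow> w l = 0)"] by blast
  have "(\<Sum>l\<le>nat (- snd D). [:1, -1, 1:] ^ l * L l) = spec0 (mvar Gt * G + (\<Sum>l\<le>nat (- snd D). w l))"
    by (simp add: spec0_simps spec0_mvar ring_homomorphism.hom_sum[OF spec0_homomorphism] L(1))
  also have "\<dots> = 0"
    using spec_cong[OF F] assms(2) by (simp add: spec0_def)
  finally have "L l = 0" if "l \<le> nat (- snd D)" for l
    using adic_expansion_zero[of "[:1, -1, 1:]" 2 L "nat (- snd D)" l] L(2) that by simp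
  then have "rees_map F = rees_map (mvar Gt * G)"
    using L(3) by (simp add: F)
  with G that show ?thesis by blast
qed

section \<open>Surjectivity onto the Cox components\<close>

lemma single_rees_part:
  assumes "f \<in> homogeneous_part weight d"
  shows "Poly_Mapping.single 0 f \<in> (rees_part (d, 0) :: 'k::comm_ring_1 laurent_mpol set)"
proof -
  let ?g = "\<lambda>v. mvar (coord_gen v) :: (gen, 'k) mpol" and ?Q = "\<lambda>v. degree_of_gen (coord_gen v)"
  have Q: "fst \<circ> ?Q = weight" "snd \<circ> ?Q = (\<lambda>_. 0)"
    by (rule ext, rename_tac v, case_tac v; simp)+
  have one: "1 \<in> (bihomogeneous_part degree_of_gen 0 :: (gen, 'k) mpol set)"
    using bihomogeneous_part_mconst[of 1]
    by (simp add: ring_homomorphism.hom_one[OF mconst_homomorphism])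
  have m: "eval_monomial ?g e \<in> bihomogeneous_part degree_of_gen (monomial_deg weight e, 0)" for e
    using monomial_memI[of "bihomogeneous_part degree_of_gen" ?g ?Q e, OF one bihomogeneous_part_mult bihomogeneous_part_mvar]
    unfolding Q by (simp add: monomial_deg_def)
  have t: "mconst (Poly_Mapping.lookup f e) * eval_monomial ?g e \<in> bihomogeneous_part degree_of_gen (d, 0)"
    if "e \<in> Poly_Mapping.keys f" for e
    using bihomogeneous_part_mult[OF bihomogeneous_part_mconst m] assms that
    by (fastforce simp: homogeneous_part_def)
  have "(\<Sum>e\<in>A. mconst (Poly_Mapping.lookup f e) * eval_monomial ?g e) \<in> bihomogeneous_part degree_of_gen (d, 0)"
    if "finite A" "A \<subseteq> Poly_Mapping.keys f" for A
    using that by (induction A) (auto simp: bihomogeneous_part_zero intro!: bihomogeneous_part_add t)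
  then have "lift_coord f \<in> (bihomogeneous_part degree_of_gen (d, 0) :: (gen, 'k) mpol set)"
    by (simp add: lift_coord_def mpol_subst_def linear_extension_def)
  then show ?thesis
    unfolding rees_part_def by (intro image_eqI[where x = "lift_coord f"]) (simp_all add: rees_map_lift_coord)
qed

text \<open>Induction on k: a preimage F of f t^(-k) satisfies \<open>spec\<close> F \<tau>^k =
  restriction of f. If \<tau>^(k+1) divides the latter, \<open>spec0\<close> F vanishes, and
  dividing by t gives a preimage of f t^(-k-1).\<close>

lemma symbolic_power_subset_rees_part:
  fixes f :: "(coord, 'k::field_char_0) mpol"
  assumes f: "f \<in> homogeneous_part weight d" and "[:0, 1:] ^ k dvd spec (lift_coord f)"
  shows "Poly_Mapping.single (- int k) f \<in> rees_part (d, - int k)"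
  using assms(2)
proof (induction k)
  case 0
  then show ?case using single_rees_part[OF f] by simp
next
  case (Suc k)
  from Suc.prems have "[:0, 1:] ^ k dvd spec (lift_coord f)"
    by (simp only: power_Suc) (rule dvd_mult_right)
  then obtain F where F: "F \<in> bihomogeneous_part degree_of_gen (d, - int k)"
      "rees_map F = Poly_Mapping.single (- int k) f"
    using Suc.IH unfolding rees_part_def by force
  \<comment> \<open>Equal images in the Rees algebra have equal restrictions, although the two
    polynomials may differ.\<close>
  have "rees_map (F * mvar Gt ^ k) = rees_map (lift_coord f)"
    by (simp add: rees_map_simps F(2) rees_map_lift_coord single_power mult_single)
  then have "spec F * [:0, 1:] ^ k = spec (lift_coord f)"
    using spec_cong[of "F * mvar Gt ^ k" "lift_coord f"] by (simp add: spec_simps spec_mvar)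
  with Suc.prems have "[:0, 1:] * [:0, 1:] ^ k dvd spec F * [:0, 1:] ^ k"
    by (simp only: power_Suc)
  moreover have "[:0, 1:] ^ k \<noteq> (0 :: 'k poly poly)"
    by simp
  ultimately have "[:0, 1:] dvd spec F"
    using dvd_mult_cancel_right[of "[:0, 1:]" "[:0, 1:] ^ k" "spec F"] by blast
  then have "spec0 F = 0"
    by (simp only: spec_dvd_iff)
  then obtain G where G: "G \<in> bihomogeneous_part degree_of_gen ((d, - int k) - (0, 1))"
      "rees_map F = rees_map (mvar Gt * G)"
    using spec0_zero_imp_t_multiple[OF F(1)] by blast
  have "Poly_Mapping.single (-1) 1 * (Poly_Mapping.single 1 1 * rees_map G) = Poly_Mapping.single (-1) 1 * Poly_Mapping.single (- int k) f"
    using G(2) by (simp add: F(2) rees_map_simps)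
  then have "rees_map G = Poly_Mapping.single (- int (Suc k)) f"
    by (simp add: mult.assoc[symmetric] mult_single)
  moreover have "(d, - int k) - (0, 1) = (d, - int (Suc k))"
    by simp
  ultimately show ?case
    using G(1) unfolding rees_part_def by (metis image_eqI)
qed

theorem component_eq_rees_part: "component D = (rees_part D :: 'k::field_char_0 laurent_mpol set)"
proof (intro equalityI subsetI)
  fix g :: "'k laurent_mpol" assume "g \<in> rees_part D"
  then show "g \<in> component D"
    using rees_map_component[of _ D] by (auto simp: rees_part_def)
next
  fix g :: "'k laurent_mpol" assume "g \<in> component D"
  then obtain f where g: "g = Poly_Mapping.single (snd D) f" and f: "f \<in> symbolic (- snd D)"
      "f \<in> homogeneous_part weight (fst D)"
    unfolding component_iff by blast
  show "g \<in> rees_part D"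
  proof (cases "snd D \<le> 0")
    case True
    then have k: "- snd D = int (nat (- snd D))" by simp
    show ?thesis
      using symbolic_power_subset_rees_part[OF f(2) symbolic_spec[of f "nat (- snd D)"]] f(1) k g by simp
  next
    case False
    \<comment> \<open>A positive second degree imposes no vanishing; the element is f times a power
      of the image of t.\<close>
    have "Poly_Mapping.single 0 f * gen_image Gt ^ nat (snd D) \<in> rees_part ((fst D, 0) + (int (nat (snd D)) * 0, int (nat (snd D)) * 1))"
      using rees_part_mult[OF single_rees_part[OF f(2)] rees_part_power[OF rees_part_gen[of Gt], of "nat (snd D)"]]
      by simp
    then show ?thesis using False by (simp add: g single_power mult_single)
  qed
qed

end

section \<open>The presentation of the Cox ring\<close>

lemma bihomogeneous_decomposition:
  fixes F :: "('v, 'k::comm_ring_1) mpol"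
  obtains A F' where "finite A" "\<And>D. F' D \<in> bihomogeneous_part Q D" "F = (\<Sum>D\<in>A. F' D)"
proof -
  let ?d = "\<lambda>e. (monomial_deg (fst \<circ> Q) e, monomial_deg (snd \<circ> Q) e)"
  have "\<exists>A F'. finite A \<and> (\<forall>D. F' D \<in> bihomogeneous_part Q D) \<and> F = (\<Sum>D\<in>A. F' D)"
  proof (induction F rule: poly_mapping_induct_add)
    case (single e c)
    let ?F = "\<lambda>D. if D = ?d e then Poly_Mapping.single e c else 0"
    have "\<forall>D. ?F D \<in> bihomogeneous_part Q D"
      by (auto simp: bihomogeneous_part_def homogeneous_part_def)
    then show ?case
      by (intro exI[of _ "{?d e}"] exI[of _ ?F]) simp
  next
    case (add F G)
    then obtain A F' B G' where *: "finite A" "\<forall>D. F' D \<in> bihomogeneous_part Q D" "F = (\<Sum>D\<in>A. F' D)"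
      "finite B" "\<forall>D. G' D \<in> bihomogeneous_part Q D" "G = (\<Sum>D\<in>B. G' D)" by blast
    let ?H = "\<lambda>D. (if D \<in> A then F' D else 0) + (if D \<in> B then G' D else 0)"
    have "\<forall>D. ?H D \<in> bihomogeneous_part Q D"
      using * by (auto intro: bihomogeneous_part_add bihomogeneous_part_zero)
    moreover have "F + G = (\<Sum>D\<in>A \<union> B. ?H D)"
      using * by (simp add: sum.distrib sum.If_cases Int_absorb1 Int_absorb2 flip: sum.inter_restrict)
    ultimately show ?case
      using * by (intro exI[of _ "A \<union> B"] exI[of _ ?H]) simp
  qed
  then show ?thesis using that by blast
qed

text \<open>Bundles the properties of the isomorphism, so that both orders of b and c lead to one
  predicate.\<close>

definition presents_cox_ring ::
    "nat \<Rightarrow> nat \<Rightarrow> nat \<Rightarrow> nat \<Rightarrow> nat \<Rightarrow> ((gen, 'k::comm_ring_1) mpol set \<Rightarrow> 'k laurent_mpol) \<Rightarrow> bool"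
  where "presents_cox_ring a b c n m \<phi> \<longleftrightarrow>
    (let I = saturated_relation_ideal b c n m; cls = (\<lambda>f. I +>\<^bsub>mpol_ring\<^esub> f)
     in \<phi> \<in> ring_iso (mpol_ring Quot I) (cox_ring a b c) \<and>
        (\<forall>k. \<phi> (cls (mconst k)) = Poly_Mapping.single 0 (mconst k)) \<and>
        (\<forall>D. \<phi> ` cls ` bihomogeneous_part (gen_deg a b c n m) D = cox_component a b c D) \<and>
        \<phi> (cls (mvar Gx)) = Poly_Mapping.single 0 (mvar Cx) \<and>
        \<phi> (cls (mvar Gy)) = Poly_Mapping.single 0 (mvar Cy) \<and>
        \<phi> (cls (mvar Gz)) = Poly_Mapping.single 0 (mvar Cz) \<and>
        \<phi> (cls (mvar Gt)) = Poly_Mapping.single 1 1)"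

context monomial_curve
begin

abbreviation "cox \<equiv> cox_ring (3 * n + q) 3 (3 * n + 2 * q)"

lemma cox_ring_eq:
  "cox = type_ring \<lparr>carrier := range (rees_map :: (gen, 'k::field_char_0) mpol \<Rightarrow> 'k laurent_mpol)\<rparr>"
proof -
  have "{(\<Sum>D\<in>A. g D) | A g. finite A \<and> (\<forall>D\<in>A. g D \<in> component D)}
      = range (rees_map :: (gen, 'k) mpol \<Rightarrow> 'k laurent_mpol)"
  proof (intro equalityI subsetI)
    fix f :: "'k laurent_mpol" assume "f \<in> {(\<Sum>D\<in>A. g D) | A g. finite A \<and> (\<forall>D\<in>A. g D \<in> component D)}"
    then obtain A g where A: "f = (\<Sum>D\<in>A. g D)" "\<forall>D\<in>A. g D \<in> component D" by blast
    have "\<forall>D\<in>A. \<exists>G. g D = rees_map G"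
      using A(2) by (auto simp: component_eq_rees_part rees_part_def)
    from bchoice[OF this] obtain G where "\<forall>D\<in>A. g D = rees_map (G D)" by blast
    then have "f = rees_map (\<Sum>D\<in>A. G D)"
      by (simp add: A(1) ring_homomorphism.hom_sum[OF rees_map_homomorphism])
    then show "f \<in> range rees_map" by blast
  next
    fix f :: "'k laurent_mpol" assume "f \<in> range rees_map"
    then obtain F where f: "f = rees_map F" by blast
    obtain A F' where F: "finite A" "\<And>D. F' D \<in> bihomogeneous_part degree_of_gen D" "F = (\<Sum>D\<in>A. F' D)"
      using bihomogeneous_decomposition[of degree_of_gen F] by metis
    have "f = (\<Sum>D\<in>A. rees_map (F' D))"
      by (simp add: f F(3) ring_homomorphism.hom_sum[OF rees_map_homomorphism])
    then show "f \<in> {(\<Sum>D\<in>A. g D) | A g. finite A \<and> (\<forall>D\<in>A. g D \<in> component D)}"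
      using F(1,2) by (intro CollectI exI[of _ A] exI[of _ "\<lambda>D. rees_map (F' D)"]) (simp add: rees_map_component)
  qed
  then show ?thesis unfolding cox_ring_def by simp
qed

text \<open>First isomorphism theorem for \<open>rees_map\<close>, whose kernel is the saturated
  relation ideal and whose range is the Cox ring. The image of a coset of the kernel is a singleton,
  and its element is the value of the isomorphism.\<close>

theorem cox_ring_presentation:
  "\<exists>\<phi> :: (gen, 'k::field_char_0) mpol set \<Rightarrow> 'k laurent_mpol.
     presents_cox_ring (3 * n + q) 3 (3 * n + 2 * q) n 1 \<phi>"
proof -
  let ?h = "rees_map :: (gen, 'k) mpol \<Rightarrow> 'k laurent_mpol" and ?R = "type_ring :: (gen, 'k) mpol ring"
  interpret h: ring_hom_ring ?R "type_ring :: 'k laurent_mpol ring" ?h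
    by (rule ring_hom_ringI[OF ring_from_type_algebra ring_from_type_algebra]) (simp_all add: rees_map_simps)
  have ker: "a_kernel ?R type_ring ?h = sat_rel_ideal"
    unfolding a_kernel_def' type_ring_simps kernel_rees_map[symmetric] by blast
  let ?\<phi> = "\<lambda>C. the_elem (?h ` C)"
  have iso: "?\<phi> \<in> ring_iso (?R Quot sat_rel_ideal) cox"
    using h.FactRing_iso_set_aux unfolding ker cox_ring_eq by simp
  have \<phi>: "?\<phi> (sat_rel_ideal +>\<^bsub>?R\<^esub> f) = ?h f" for f
  proof -
    have "?h ` (sat_rel_ideal +>\<^bsub>?R\<^esub> f) = (\<lambda>g. ?h g + ?h f) ` {g. ?h g = 0}"
      by (simp add: a_r_coset_def' kernel_rees_map UNION_singleton_eq_range image_image rees_map_simps)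
    also have "\<dots> = (\<lambda>g. ?h f) ` {g. ?h g = 0}"
      by (rule image_cong) simp_all
    also have "\<dots> = {?h f}"
      using rees_map_simps(4) by (intro image_constant) simp
    finally show ?thesis by simp
  qed
  show ?thesis
    unfolding presents_cox_ring_def Let_def
    by (intro exI[of _ ?\<phi>] conjI allI iso) (simp_all only: \<phi> image_image component_eq_rees_part rees_part_def
        rees_map_mvar rees_map_mconst gen_image.simps)
qed

end

text \<open>Modulo 3, c differs from b, since otherwise c = b + 3i; hence c is congruent to 2b.
  Moreover c < 2b, since otherwise c = 2b + 3i. So 2b - c = 3n with n > 0, and q = c - b.\<close>

lemma numerical_reordering:
  fixes b c :: nat
  assumes "b > 0" "coprime 3 b" "coprime 3 c" "b \<le> c"
    and "\<not> (\<exists>i j :: nat. c = i * 3 + j * b)"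
  obtains n q where "b = 3 * n + q" "c = 3 * n + 2 * q" "n > 0" "\<not> 3 dvd q"
proof -
  have b: "\<not> 3 dvd b" and c: "\<not> 3 dvd c"
    using assms(2,3) by (auto simp: coprime_absorb_left)
  have "\<not> 3 dvd c - b"
  proof
    assume "3 dvd c - b"
    then have "c = ((c - b) div 3) * 3 + 1 * b" using assms(4) by simp
    then show False using assms(5) by blast
  qed
  \<comment> \<open>The residues of b and c are 1 and 2 in some order, so b + c is divisible by
    3.\<close>
  then have mod: "3 dvd 2 * b + 2 * c" and mod': "\<not> 3 dvd c - b"
    using b c assms(4) by presburger+
  have less: "c < 2 * b"
  proof (rule ccontr)
    assume "\<not> c < 2 * b"
    then have "3 dvd c - 2 * b" using mod by presburger
    then have "c = ((c - 2 * b) div 3) * 3 + 2 * b" using \<open>\<not> c < 2 * b\<close> by simp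
    then show False using assms(5) by blast
  qed
  have "3 dvd 2 * b - c" using mod less by presburger
  then obtain n where n: "2 * b - c = 3 * n" by (elim dvdE)
  show ?thesis
    by (rule that[of n "c - b"]) (use n less assms(4) mod' in simp_all)
qed

lemma cox_ring_of_ordered_triple:
  fixes b c :: nat
  assumes "b > 0" "coprime 3 b" "coprime 3 c" "b \<le> c"
    and "\<not> (\<exists>i j :: nat. c = i * 3 + j * b)"
  obtains n and \<phi> :: "(gen, 'k::field_char_0) mpol set \<Rightarrow> 'k laurent_mpol"
    where "n > 0" "2 * b = n * 3 + 1 * c" "3 * n \<le> c" "even (c - n)" "presents_cox_ring b 3 c n 1 \<phi>"
proof -
  obtain n q where nq: "b = 3 * n + q" "c = 3 * n + 2 * q" "n > 0" "\<not> 3 dvd q"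
    using numerical_reordering[OF assms] by blast
  interpret monomial_curve n q using nq by unfold_locales
  obtain \<phi> :: "(gen, 'k) mpol set \<Rightarrow> 'k laurent_mpol" where "presents_cox_ring b 3 c n 1 \<phi>"
    using cox_ring_presentation nq(1,2) by metis
  then show ?thesis
    by (intro that[of n \<phi>]) (use nq in \<open>simp_all add: algebra_simps\<close>)
qed

theorem corollary5p3:
  fixes b c :: nat
  assumes "b > 0" and "c > 0"
    and "coprime 3 b" and "coprime 3 c" and "coprime b c"
    and "\<not> (\<exists>i j :: nat. 3 = i * b + j * c)"
    and "\<not> (\<exists>i j :: nat. b = i * 3 + j * c)"
    and "\<not> (\<exists>i j :: nat. c = i * 3 + j * b)"
  shows "\<exists>a' b' c' n m :: nat.
    {#a', b', c'#} = {#3, b, c#} \<and> n > 0 \<and> m > 0 \<and> 2 * a' = n * b' + m * c' \<and>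
    3 * m \<le> b' \<and> 3 * n \<le> c' \<and> even (b' - m) \<and> even (c' - n) \<and>
    (let I = (saturated_relation_ideal b' c' n m ::
                (gen, 'k::{alg_closed_field, field_char_0}) mpol set);
         cls = (\<lambda>f. I +>\<^bsub>mpol_ring\<^esub> f)
     in \<exists>\<phi> \<in> ring_iso (mpol_ring Quot I) (cox_ring a' b' c').
          (\<forall>k. \<phi> (cls (mconst k)) = Poly_Mapping.single 0 (mconst k)) \<and>
          (\<forall>D. \<phi> ` cls ` bihomogeneous_part (gen_deg a' b' c' n m) D = cox_component a' b' c' D) \<and>
          \<phi> (cls (mvar Gx)) = Poly_Mapping.single 0 (mvar Cx) \<and>
          \<phi> (cls (mvar Gy)) = Poly_Mapping.single 0 (mvar Cy) \<and>
          \<phi> (cls (mvar Gz)) = Poly_Mapping.single 0 (mvar Cz) \<and>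
          \<phi> (cls (mvar Gt)) = Poly_Mapping.single 1 1)"
proof -
  have "\<exists>a c' n (\<phi> :: (gen, 'k) mpol set \<Rightarrow> 'k laurent_mpol). {#a, 3, c'#} = {#3, b, c#} \<and> n > 0 \<and>
      2 * a = n * 3 + 1 * c' \<and> 3 * n \<le> c' \<and> even (c' - n) \<and> presents_cox_ring a 3 c' n 1 \<phi>"
  \<comment> \<open>In both cases b' = 3 and m = 1; the smaller of b and c becomes a', the larger
    becomes c'.\<close>
  proof (cases "b \<le> c")
    case True
    obtain n and \<phi> :: "(gen, 'k) mpol set \<Rightarrow> 'k laurent_mpol"
      where *: "n > 0" "2 * b = n * 3 + 1 * c" "3 * n \<le> c" "even (c - n)" "presents_cox_ring b 3 c n 1 \<phi>"
      by (rule cox_ring_of_ordered_triple[OF assms(1,3,4) True assms(8)])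
    have "{#b, 3, c#} = {#3, b, c#}"
      by (rule add_mset_commute)
    with * show ?thesis by blast
  next
    case False
    then have "c \<le> b" by simp
    obtain n and \<phi> :: "(gen, 'k) mpol set \<Rightarrow> 'k laurent_mpol"
      where *: "n > 0" "2 * c = n * 3 + 1 * b" "3 * n \<le> b" "even (b - n)" "presents_cox_ring c 3 b n 1 \<phi>"
      by (rule cox_ring_of_ordered_triple[OF assms(2,4,3) \<open>c \<le> b\<close> assms(7)])
    have "{#c, 3, b#} = {#3, b, c#}"
      by (simp add: add_mset_commute)
    with * show ?thesis by blast
  qed
  then obtain a c' n and \<phi> :: "(gen, 'k) mpol set \<Rightarrow> 'k laurent_mpol"
    where *: "{#a, 3, c'#} = {#3, b, c#}" "n > 0" "2 * a = n * 3 + 1 * c'" "3 * n \<le> c'" "even (c' - n)"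
      and \<phi>: "presents_cox_ring a 3 c' n 1 \<phi>"
    by blast
  show ?thesis
    using \<phi> unfolding presents_cox_ring_def Let_def
    by (intro exI[of _ a] exI[of _ 3] exI[of _ c'] exI[of _ n] exI[of _ 1] conjI bexI[of _ \<phi>] *)
      (simp_all only: zero_less_one, simp_all)
qed

end
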